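(* Suppose that for every Banach space $E$ over $\mathbb{K}$ the spaces $F(\Omega)$ and $F(\Omega,E)$ are $\varepsilon$-into-compatible and $(T^{E},T^{\mathbb{K}})$ is a generator for $(\mathcal{F}\nu,E)$ and a strong, consistent family for $(F,E)$. Let $F(\Omega)$ be a nuclear Fréchet space and $\mathcal{F}\nu(\Omega)$ a Banach space whose closed unit ball $B_{\mathcal{F}\nu(\Omega)}$ is a compact subset of $F(\Omega)$, and let the sequence $(x_{n})_{n\in\mathbb{N}}$ in $\omega$ fix the topology in $\mathcal{F}\nu(\Omega)$. a) Then there is $\lambda\in\ell^{1}$ with $\lambda_n>0$ for all $n\in\mathbb{N}$ such that for every bounded $B\subset F(\Omega)_{b}'$ there is $C\geq 1$ with \[ \{\mu_{\mid\mathcal{F}\nu(\Omega)}\;|\;\mu\in B\}\subset\Bigl\{\sum_{n=1}^{\infty}a_{n}\nu(x_{n})T^{\mathbb{K}}_{x_{n}}\in\mathcal{F}\nu(\Omega)'\;\Big|\;a\in\ell^{1},\;\forall n\in\mathbb{N}:\ |a_{n}|\leq C\lambda_{n}\Bigr\}. \] b) Let $(\|\cdot\|_{k})_{k\in\mathbb{N}}$ denote the system of seminorms generating the topology of $F(\Omega)$. Then there is a decreasing zero sequence $(\varepsilon_{n})_{n\in\mathbb{N}}$ such that for all $k\in\mathbb{N}$ there is $C\geq 1$ with \[ \|f\|_{k}\leq C\sup_{n\in\mathbb{N}}|T^{\mathbb{K}}(f)(x_{n})|\nu(x_{n})\varepsilon_{n},\quad f\in\mathcal{F}\nu(\Omega).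 \]
   Context: $\mathbb{K}=\mathbb{R}$ or $\mathbb{C}$. All spaces are non-trivial. An lcHs is a locally convex Hausdorff space over $\mathbb{K}$; $X'_b$ is the strong dual. For an lcHs $X$, $X'_{\kappa}$ is $X'$ with the topology of uniform convergence on absolutely convex compact subsets of $X$, and $X\varepsilon E:=L_{e}(X'_{\kappa},E)$ carries the topology of uniform convergence on equicontinuous subsets of $X'$. $\delta_x(f):=f(x)$. Setting: $\Omega,\omega$ are non-empty sets, $\nu\colon\omega\to(0,\infty)$. For $Y=\mathbb{K}$ and every Banach space $Y=E$ (norm $\|\cdot\|_Y$), $T^{Y}\colon Y^{\Omega}\supset\operatorname{dom}T^{Y}\to Y^{\omega}$ is linear, $\operatorname{AP}(\Omega,Y)\subset Y^{\Omega}$ is a linear subspace, $F(\Omega,Y)=\operatorname{AP}(\Omega,Y)\cap\operatorname{dom}T^{Y}$ (and $F(\Omega)=F(\Omega,\mathbb{K})$) is equipped with a locally convex Hausdorff topology, with $\delta_x\in F(\Omega)'$ for all $x\in\Omega$, and \[ \mathcal{F}\nu(\Omega,Y)=\{f\in F(\Omega,Y)\;|\;|f|:=\sup_{x\in\omega}\|T^{Y}(f)(x)\|_Y\,\nu(x)<\infty\} \] carries the seminorm $|\cdot|$; $\mathcal{F}\nu(\Omega)=\mathcal{F}\nu(\Omega,\mathbb{K})$ with norm $|\cdot|_{\mathcal{F}\nu(\Omega)}$. $(T^{E},T^{\mathbb{K}})$ is a generator for $(\mathcal{F}\nu,E)$ if $\mathcal{F}\nu(\Omega)$ and $\mathcal{F}\nu(\Omega,E)$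 are Hausdorff and $\delta_x\in\mathcal{F}\nu(\Omega)'$ for all $x\in\Omega$. Put $T^{\mathbb{K}}_x:=\delta_x\circ T^{\mathbb{K}}$, $x\in\omega$. $F(\Omega)$ and $F(\Omega,E)$ are $\varepsilon$-into-compatible if $S\colon F(\Omega)\varepsilon E\to F(\Omega,E)$, $u\mapsto[x\mapsto u(\delta_x)]$, is a well-defined topological isomorphism onto its range. $(T^{E},T^{\mathbb{K}})$ is consistent for $(F,E)$ if for all $u\in F(\Omega)\varepsilon E$, $x\in\omega$: $S(u)\in F(\Omega,E)$, $T^{\mathbb{K}}_x\in F(\Omega)'$, $T^{E}(S(u))(x)=u(T^{\mathbb{K}}_x)$; strong if for all $e'\in E'$, $f\in F(\Omega,E)$, $x\in\omega$: $e'\circ f\in F(\Omega)$ and $T^{\mathbb{K}}(e'\circ f)(x)=e'(T^{E}(f)(x))$. $(x_n)_{n\in\mathbb{N}}\subset\omega$ fixes the topology in $\mathcal{F}\nu(\Omega)$ if there is $C>0$ with $|f|_{\mathcal{F}\nu(\Omega)}\le C\sup_{n\in\mathbb{N}}|T^{\mathbb{K}}(f)(x_n)|\nu(x_n)$ for all $f\in\mathcal{F}\nu(\Omega)$. *)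

theory Defs
  imports "HOL-Analysis.Analysis" "HOL-Library.Function_Algebras"
begin

section \<open>Scalars\<close>

text \<open>The scalar field is, up to an isometric field isomorphism, the reals or the
  complex numbers.\<close>

class real_or_complex = real_normed_field +
  assumes real_or_complex:
    "(\<exists>\<phi>::'a \<Rightarrow> real. bij \<phi> \<and> (\<forall>a b. \<phi> (a + b) = \<phi> a + \<phi> b) \<and> (\<forall>a b. \<phi> (a * b) = \<phi> a * \<phi> b) \<and> (\<forall>a. norm (\<phi> a) = norm a)) \<or>
     (\<exists>\<phi>::'a \<Rightarrow> complex. bij \<phi> \<and> (\<forall>a b. \<phi> (a + b) = \<phi> a + \<phi> b) \<and> (\<forall>a b. \<phi> (a * b) = \<phi> a * \<phi> b) \<and> (\<forall>a. norm (\<phi> a) = norm a))"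

instance real :: real_or_complex
proof
  have "\<exists>\<phi>::real \<Rightarrow> real. bij \<phi> \<and> (\<forall>a b. \<phi> (a + b) = \<phi> a + \<phi> b) \<and> (\<forall>a b. \<phi> (a * b) = \<phi> a * \<phi> b) \<and> (\<forall>a. norm (\<phi> a) = norm a)"
    by (intro exI[of _ "\<lambda>x. x"]) (auto intro: bij_id[unfolded id_def])
  then show "(\<exists>\<phi>::real \<Rightarrow> real. bij \<phi> \<and> (\<forall>a b. \<phi> (a + b) = \<phi> a + \<phi> b) \<and> (\<forall>a b. \<phi> (a * b) = \<phi> a * \<phi> b) \<and> (\<forall>a. norm (\<phi> a) = norm a)) \<or>
     (\<exists>\<phi>::real \<Rightarrow> complex. bij \<phi> \<and> (\<forall>a b. \<phi> (a + b) = \<phi> a + \<phi> b) \<and> (\<forall>a b. \<phi> (a * b) = \<phi> a * \<phi> b) \<and> (\<forall>a. norm (\<phi> a) = norm a))" ..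
qed

instance complex :: real_or_complex
proof
  have "\<exists>\<phi>::complex \<Rightarrow> complex. bij \<phi> \<and> (\<forall>a b. \<phi> (a + b) = \<phi> a + \<phi> b) \<and> (\<forall>a b. \<phi> (a * b) = \<phi> a * \<phi> b) \<and> (\<forall>a. norm (\<phi> a) = norm a)"
    by (intro exI[of _ "\<lambda>x. x"]) (auto intro: bij_id[unfolded id_def])
  then show "(\<exists>\<phi>::complex \<Rightarrow> real. bij \<phi> \<and> (\<forall>a b. \<phi> (a + b) = \<phi> a + \<phi> b) \<and> (\<forall>a b. \<phi> (a * b) = \<phi> a * \<phi> b) \<and> (\<forall>a. norm (\<phi> a) = norm a)) \<or>
     (\<exists>\<phi>::complex \<Rightarrow> complex. bij \<phi> \<and> (\<forall>a b. \<phi> (a + b) = \<phi> a + \<phi> b) \<and> (\<forall>a b. \<phi> (a * b) = \<phi> a * \<phi> b) \<and> (\<forall>a. norm (\<phi> a) = norm a))" ..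
qed


section \<open>Locally convex spaces\<close>

text \<open>
  A vector space over \<open>'k\<close> is a subspace of an ambient type \<open>'v\<close> with scalar multiplication
  \<open>s\<close> (\<open>vector_space s\<close>). A topological vector space is given by \<open>s\<close> and an abstract topology
  whose \<open>topspace\<close> is the subspace in question.
  Function spaces are subspaces of the space of all functions, with pointwise operations.
\<close>

definition fscale :: "('k \<Rightarrow> 'v \<Rightarrow> 'v) \<Rightarrow> 'k \<Rightarrow> ('a \<Rightarrow> 'v) \<Rightarrow> 'a \<Rightarrow> 'v"
  where "fscale s c f = (\<lambda>t. s c (f t))"

lemma vector_space_fscale:
  fixes s :: "'k::field \<Rightarrow> 'v::ab_group_add \<Rightarrow> 'v"
  assumes "vector_space s"
  shows "vector_space (fscale s :: 'k \<Rightarrow> ('a \<Rightarrow> 'v) \<Rightarrow> 'a \<Rightarrow> 'v)"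
  using assms by (auto simp: vector_space_def fscale_def fun_eq_iff)

definition linear_on ::
  "('k \<Rightarrow> 'v \<Rightarrow> 'v) \<Rightarrow> ('k \<Rightarrow> 'w \<Rightarrow> 'w) \<Rightarrow> 'v::ab_group_add set \<Rightarrow> ('v \<Rightarrow> 'w::ab_group_add) \<Rightarrow> bool"
  where "linear_on s t V u \<longleftrightarrow>
    (\<forall>x\<in>V. \<forall>y\<in>V. u (x + y) = u x + u y) \<and> (\<forall>c. \<forall>x\<in>V. u (s c x) = t c (u x))"

definition seminorm_on ::
  "('k::real_normed_field \<Rightarrow> 'v \<Rightarrow> 'v) \<Rightarrow> 'v::ab_group_add set \<Rightarrow> ('v \<Rightarrow> real) \<Rightarrow> bool"
  where "seminorm_on s V p \<longleftrightarrow>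
    (\<forall>x\<in>V. \<forall>y\<in>V. p (x + y) \<le> p x + p y) \<and> (\<forall>c. \<forall>x\<in>V. p (s c x) = norm c * p x)"

text \<open>The topology on \<open>V\<close> generated by a family \<open>P\<close> of seminorms. Inserting \<open>V\<close> into the subbase
  only matters for empty \<open>P\<close>.\<close>

definition seminorm_topology :: "'v::ab_group_add set \<Rightarrow> ('v \<Rightarrow> real) set \<Rightarrow> 'v topology"
  where "seminorm_topology V P =
    topology_generated_by (insert V {{y\<in>V. p (y - x) < r} | p x r. p \<in> P \<and> x \<in> V \<and> 0 < r})"

lemma topspace_seminorm_topology [simp]: "topspace (seminorm_topology V P) = V"
  unfolding seminorm_topology_def topology_generated_by_topspace by auto

definition lcHs :: "('k::real_normed_field \<Rightarrow> 'v \<Rightarrow> 'v) \<Rightarrow> 'v::ab_group_add topology \<Rightarrow> bool"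
  where "lcHs s X \<longleftrightarrow>
    module.subspace s (topspace X) \<and> topspace X \<noteq> {0} \<and> Hausdorff_space X \<and>
    (\<exists>P. (\<forall>p\<in>P. seminorm_on s (topspace X) p) \<and> X = seminorm_topology (topspace X) P)"

definition frechet_space :: "('k::real_normed_field \<Rightarrow> 'v \<Rightarrow> 'v) \<Rightarrow> 'v::ab_group_add topology \<Rightarrow> bool"
  where "frechet_space s X \<longleftrightarrow>
    lcHs s X \<and> metrizable_space X \<and>
    (\<forall>\<sigma>. range \<sigma> \<subseteq> topspace X \<and>
        (\<forall>U. openin X U \<and> 0 \<in> U \<longrightarrow> (\<exists>M. \<forall>m\<ge>M. \<forall>n\<ge>M. \<sigma> m - \<sigma> n \<in> U))
      \<longrightarrow> (\<exists>l. limitin X \<sigma> l sequentially))"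

definition continuous_seminorm ::
  "('k::real_normed_field \<Rightarrow> 'v \<Rightarrow> 'v) \<Rightarrow> 'v::ab_group_add topology \<Rightarrow> ('v \<Rightarrow> real) \<Rightarrow> bool"
  where "continuous_seminorm s X p \<longleftrightarrow>
    seminorm_on s (topspace X) p \<and> continuous_map X euclideanreal p"

text \<open>For seminorms \<open>p \<le> q\<close> on \<open>V\<close>, nuclearity (in the sense of Pietsch) of the canonical map
  \<open>V/ker q \<rightarrow> V/ker p\<close> between the associated normed spaces: it is a series
  \<open>\<Sum>\<^sub>j a\<^sub>j \<otimes> y\<^sub>j\<close> with \<open>\<Sum>\<^sub>j \<parallel>a\<^sub>j\<parallel> \<parallel>y\<^sub>j\<parallel> < \<infinity>\<close>. A functional on \<open>V/ker q\<close> of norm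
  at most \<open>\<alpha>\<close> is a linear functional on \<open>V\<close> dominated by \<open>\<alpha> q\<close>.\<close>

definition nuclear_canonical_map ::
  "('k::real_normed_field \<Rightarrow> 'v \<Rightarrow> 'v) \<Rightarrow> 'v::ab_group_add set \<Rightarrow> ('v \<Rightarrow> real) \<Rightarrow> ('v \<Rightarrow> real) \<Rightarrow> bool"
  where "nuclear_canonical_map s V q p \<longleftrightarrow>
    (\<exists>(a :: nat \<Rightarrow> 'v \<Rightarrow> 'k) (\<alpha> :: nat \<Rightarrow> real) (y :: nat \<Rightarrow> 'v).
      (\<forall>j. linear_on s (*) V (a j) \<and> (\<forall>x\<in>V. norm (a j x) \<le> \<alpha> j * q x) \<and> 0 \<le> \<alpha> j \<and> y j \<in> V) \<and>
      summable (\<lambda>j. \<alpha> j * p (y j)) \<and>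
      (\<forall>x\<in>V. (\<lambda>n. p (x - (\<Sum>j<n. s (a j x) (y j)))) \<longlonglongrightarrow> 0))"

definition nuclear_space :: "('k::real_normed_field \<Rightarrow> 'v \<Rightarrow> 'v) \<Rightarrow> 'v::ab_group_add topology \<Rightarrow> bool"
  where "nuclear_space s X \<longleftrightarrow>
    (\<forall>p. continuous_seminorm s X p \<longrightarrow>
      (\<exists>q. continuous_seminorm s X q \<and> (\<forall>x\<in>topspace X. p x \<le> q x) \<and>
           nuclear_canonical_map s (topspace X) q p))"

text \<open>A normed space is a pair of a carrier \<open>V\<close> and a norm \<open>N\<close>; values of \<open>N\<close> outside \<open>V\<close> are
  irrelevant.\<close>

definition banach_space ::
  "('k::real_normed_field \<Rightarrow> 'v \<Rightarrow> 'v) \<Rightarrow> 'v::ab_group_add set \<Rightarrow> ('v \<Rightarrow> real) \<Rightarrow> bool"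
  where "banach_space s V N \<longleftrightarrow>
    module.subspace s V \<and> V \<noteq> {0} \<and> seminorm_on s V N \<and> (\<forall>x\<in>V. N x = 0 \<longrightarrow> x = 0) \<and>
    (\<forall>\<sigma>. range \<sigma> \<subseteq> V \<and> (\<forall>e>0. \<exists>M. \<forall>m\<ge>M. \<forall>n\<ge>M. N (\<sigma> m - \<sigma> n) < e)
      \<longrightarrow> (\<exists>l\<in>V. (\<lambda>n. N (\<sigma> n - l)) \<longlonglongrightarrow> 0))"

abbreviation norm_topology :: "'v::ab_group_add set \<Rightarrow> ('v \<Rightarrow> real) \<Rightarrow> 'v topology"
  where "norm_topology V N \<equiv> seminorm_topology V {N}"


section \<open>Duals and the \<open>\<epsilon>\<close>-product\<close>

text \<open>Maps defined on a subspace \<open>V\<close> only are represented by total functions vanishing outside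
  \<open>V\<close>, so that spaces of such maps are again subspaces of a full function space.\<close>

definition zero_ext :: "'v set \<Rightarrow> ('v \<Rightarrow> 'w::zero) \<Rightarrow> 'v \<Rightarrow> 'w"
  where "zero_ext V u = (\<lambda>x. if x \<in> V then u x else 0)"

definition dual :: "('k::real_normed_field \<Rightarrow> 'v \<Rightarrow> 'v) \<Rightarrow> 'v::ab_group_add topology \<Rightarrow> ('v \<Rightarrow> 'k) set"
  where "dual s X =
    {u. (\<forall>x. x \<notin> topspace X \<longrightarrow> u x = 0) \<and> linear_on s (*) (topspace X) u \<and>
        continuous_map X euclidean u}"

definition tvs_bounded :: "('k::real_normed_field \<Rightarrow> 'v \<Rightarrow> 'v) \<Rightarrow> 'v::ab_group_add topology \<Rightarrow> 'v set \<Rightarrow> bool"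
  where "tvs_bounded s X B \<longleftrightarrow>
    B \<subseteq> topspace X \<and>
    (\<forall>U. openin X U \<and> 0 \<in> U \<longrightarrow> (\<exists>r>0. \<forall>c. r \<le> norm c \<longrightarrow> B \<subseteq> s c ` U))"

definition absolutely_convex :: "('k::real_normed_field \<Rightarrow> 'v \<Rightarrow> 'v) \<Rightarrow> 'v::ab_group_add set \<Rightarrow> bool"
  where "absolutely_convex s K \<longleftrightarrow>
    (\<forall>x\<in>K. \<forall>y\<in>K. \<forall>a b. norm a + norm b \<le> 1 \<longrightarrow> s a x + s b y \<in> K)"

definition equicontinuous ::
  "('k::real_normed_field \<Rightarrow> 'v \<Rightarrow> 'v) \<Rightarrow> 'v::ab_group_add topology \<Rightarrow> ('v \<Rightarrow> 'k) set \<Rightarrow> bool"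
  where "equicontinuous s X M \<longleftrightarrow>
    M \<subseteq> dual s X \<and>
    (\<forall>e>0. \<exists>U. openin X U \<and> 0 \<in> U \<and> (\<forall>u\<in>M. \<forall>x\<in>U. norm (u x) < e))"

text \<open>The topology on \<open>H\<close> of uniform convergence on the members of \<open>\<SS>\<close>, for maps into a space
  normed by \<open>N\<close>.\<close>

definition uniform_topology ::
  "('w \<Rightarrow> real) \<Rightarrow> ('v \<Rightarrow> 'w::ab_group_add) set \<Rightarrow> 'v set set \<Rightarrow> ('v \<Rightarrow> 'w) topology"
  where "uniform_topology N H \<SS> =
    seminorm_topology H {(\<lambda>h. SUP x\<in>A. N (h x)) | A. A \<in> \<SS> \<and> A \<noteq> {}}"

definition strong_dual ::
  "('k::real_normed_field \<Rightarrow> 'v \<Rightarrow> 'v) \<Rightarrow> 'v::ab_group_add topology \<Rightarrow> ('v \<Rightarrow> 'k) topology"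
  where "strong_dual s X = uniform_topology norm (dual s X) {B. tvs_bounded s X B}"

definition kappa_dual ::
  "('k::real_normed_field \<Rightarrow> 'v \<Rightarrow> 'v) \<Rightarrow> 'v::ab_group_add topology \<Rightarrow> ('v \<Rightarrow> 'k) topology"
  where "kappa_dual s X =
    uniform_topology norm (dual s X) {K. compactin X K \<and> absolutely_convex s K}"

text \<open>The \<open>\<epsilon>\<close>-product of the space \<open>X\<close> and the normed space \<open>(E, N)\<close> with scalar
  multiplication \<open>t\<close>.\<close>

definition eps_product ::
  "('k::real_normed_field \<Rightarrow> 'v \<Rightarrow> 'v) \<Rightarrow> 'v::ab_group_add topology \<Rightarrow>
   ('k \<Rightarrow> 'e \<Rightarrow> 'e) \<Rightarrow> 'e::ab_group_add set \<Rightarrow> ('e \<Rightarrow> real) \<Rightarrow> (('v \<Rightarrow> 'k) \<Rightarrow> 'e) set"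
  where "eps_product s X t E N =
    {u. (\<forall>\<mu>. \<mu> \<notin> dual s X \<longrightarrow> u \<mu> = 0) \<and> linear_on (fscale (*)) t (dual s X) u \<and>
        continuous_map (kappa_dual s X) (norm_topology E N) u}"

definition eps_topology ::
  "('k::real_normed_field \<Rightarrow> 'v \<Rightarrow> 'v) \<Rightarrow> 'v::ab_group_add topology \<Rightarrow>
   ('k \<Rightarrow> 'e \<Rightarrow> 'e) \<Rightarrow> 'e::ab_group_add set \<Rightarrow> ('e \<Rightarrow> real) \<Rightarrow> (('v \<Rightarrow> 'k) \<Rightarrow> 'e) topology"
  where "eps_topology s X t E N =
    uniform_topology N (eps_product s X t E N) {M. equicontinuous s X M}"


section \<open>Weighted function spaces\<close>

text \<open>The sets \<open>\<Omega>\<close> and \<open>\<omega>\<close> are the types \<open>'o\<close> and \<open>'w\<close>. For one space \<open>Y\<close> of values (with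
  ambient type \<open>'y\<close>), a record collects \<open>dom T\<^sup>Y\<close>, \<open>T\<^sup>Y\<close>, \<open>AP(\<Omega>,Y)\<close> and the topology of
  \<open>F(\<Omega>,Y)\<close>. Values of \<open>T\<^sup>Y\<close> outside its domain are irrelevant.\<close>

record ('o, 'w, 'y) fun_data =
  dom_T :: "('o \<Rightarrow> 'y) set"
  op_T :: "('o \<Rightarrow> 'y) \<Rightarrow> 'w \<Rightarrow> 'y"
  AP :: "('o \<Rightarrow> 'y) set"
  top_F :: "('o \<Rightarrow> 'y) topology"

definition F_space :: "('o, 'w, 'y) fun_data \<Rightarrow> ('o \<Rightarrow> 'y) set"
  where "F_space D = AP D \<inter> dom_T D"

definition fun_setting ::
  "('k::real_normed_field \<Rightarrow> 'y \<Rightarrow> 'y) \<Rightarrow> 'y::ab_group_add set \<Rightarrow> ('o, 'w, 'y) fun_data \<Rightarrow> bool"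
  where "fun_setting s Y D \<longleftrightarrow>
    module.subspace (fscale s) (dom_T D) \<and> dom_T D \<subseteq> {f. range f \<subseteq> Y} \<and>
    linear_on (fscale s) (fscale s) (dom_T D) (op_T D) \<and>
    (\<forall>f\<in>dom_T D. range (op_T D f) \<subseteq> Y) \<and>
    module.subspace (fscale s) (AP D) \<and> AP D \<subseteq> {f. range f \<subseteq> Y} \<and>
    topspace (top_F D) = F_space D \<and> lcHs (fscale s) (top_F D)"

text \<open>\<open>\<F>\<nu>(\<Omega>,Y)\<close>, its seminorm and its topology.\<close>

definition Fnu :: "('y \<Rightarrow> real) \<Rightarrow> ('w \<Rightarrow> real) \<Rightarrow> ('o, 'w, 'y) fun_data \<Rightarrow> ('o \<Rightarrow> 'y) set"
  where "Fnu N \<nu> D = {f \<in> F_space D. bdd_above (range (\<lambda>t. N (op_T D f t) * \<nu> t))}"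

definition Fnu_norm :: "('y \<Rightarrow> real) \<Rightarrow> ('w \<Rightarrow> real) \<Rightarrow> ('o, 'w, 'y) fun_data \<Rightarrow> ('o \<Rightarrow> 'y) \<Rightarrow> real"
  where "Fnu_norm N \<nu> D f = (SUP t. N (op_T D f t) * \<nu> t)"

abbreviation Fnu_topology ::
  "('y::ab_group_add \<Rightarrow> real) \<Rightarrow> ('w \<Rightarrow> real) \<Rightarrow> ('o, 'w, 'y) fun_data \<Rightarrow> ('o \<Rightarrow> 'y) topology"
  where "Fnu_topology N \<nu> D \<equiv> norm_topology (Fnu N \<nu> D) (Fnu_norm N \<nu> D)"

text \<open>The functionals \<open>\<delta>\<^sub>t\<close> and \<open>T\<^sub>t = \<delta>\<^sub>t \<circ> T\<close> on a space \<open>V\<close> of scalar functions.\<close>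

definition delta :: "('o \<Rightarrow> 'k::zero) set \<Rightarrow> 'o \<Rightarrow> ('o \<Rightarrow> 'k) \<Rightarrow> 'k"
  where "delta V t = zero_ext V (\<lambda>f. f t)"

definition T_at :: "('o, 'w, 'k::zero) fun_data \<Rightarrow> ('o \<Rightarrow> 'k) set \<Rightarrow> 'w \<Rightarrow> ('o \<Rightarrow> 'k) \<Rightarrow> 'k"
  where "T_at D V t = zero_ext V (\<lambda>f. op_T D f t)"

text \<open>In the following, \<open>K\<close> is the scalar data and \<open>D\<close> the data for values in the Banach space
  \<open>(E, N)\<close> with scalar multiplication \<open>s\<close>.\<close>

definition S_map :: "('o, 'w, 'k::zero) fun_data \<Rightarrow> ((('o \<Rightarrow> 'k) \<Rightarrow> 'k) \<Rightarrow> 'e) \<Rightarrow> 'o \<Rightarrow> 'e"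
  where "S_map K u = (\<lambda>t. u (delta (F_space K) t))"

definition eps_into_compatible ::
  "('o, 'w, 'k::real_normed_field) fun_data \<Rightarrow> ('k \<Rightarrow> 'e \<Rightarrow> 'e) \<Rightarrow> 'e::ab_group_add set \<Rightarrow>
   ('e \<Rightarrow> real) \<Rightarrow> ('o, 'w, 'e) fun_data \<Rightarrow> bool"
  where "eps_into_compatible K s E N D \<longleftrightarrow>
    (\<forall>t. delta (F_space K) t \<in> dual (fscale (*)) (top_F K)) \<and>
    S_map K ` eps_product (fscale (*)) (top_F K) s E N \<subseteq> F_space D \<and>
    linear_on (fscale s) (fscale s) (eps_product (fscale (*)) (top_F K) s E N) (S_map K) \<and>
    embedding_map (eps_topology (fscale (*)) (top_F K) s E N) (top_F D) (S_map K)"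

definition generator ::
  "('w \<Rightarrow> real) \<Rightarrow> ('o, 'w, 'k::real_normed_field) fun_data \<Rightarrow>
   ('e::ab_group_add \<Rightarrow> real) \<Rightarrow> ('o, 'w, 'e) fun_data \<Rightarrow> bool"
  where "generator \<nu> K N D \<longleftrightarrow>
    Hausdorff_space (Fnu_topology norm \<nu> K) \<and> Hausdorff_space (Fnu_topology N \<nu> D) \<and>
    (\<forall>t. delta (Fnu norm \<nu> K) t \<in> dual (fscale (*)) (Fnu_topology norm \<nu> K))"

definition consistent ::
  "('o, 'w, 'k::real_normed_field) fun_data \<Rightarrow> ('k \<Rightarrow> 'e \<Rightarrow> 'e) \<Rightarrow> 'e::ab_group_add set \<Rightarrow>
   ('e \<Rightarrow> real) \<Rightarrow> ('o, 'w, 'e) fun_data \<Rightarrow> bool"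
  where "consistent K s E N D \<longleftrightarrow>
    (\<forall>u \<in> eps_product (fscale (*)) (top_F K) s E N. \<forall>t.
      S_map K u \<in> F_space D \<and>
      T_at K (F_space K) t \<in> dual (fscale (*)) (top_F K) \<and>
      op_T D (S_map K u) t = u (T_at K (F_space K) t))"

definition strong_family ::
  "('o, 'w, 'k::real_normed_field) fun_data \<Rightarrow> ('k \<Rightarrow> 'e \<Rightarrow> 'e) \<Rightarrow> 'e::ab_group_add set \<Rightarrow>
   ('e \<Rightarrow> real) \<Rightarrow> ('o, 'w, 'e) fun_data \<Rightarrow> bool"
  where "strong_family K s E N D \<longleftrightarrow>
    (\<forall>e' \<in> dual s (norm_topology E N). \<forall>f \<in> F_space D. \<forall>t.
      e' \<circ> f \<in> F_space K \<and> op_T K (e' \<circ> f) t = e' (op_T D f t))"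

definition fixes_topology ::
  "('w \<Rightarrow> real) \<Rightarrow> ('o, 'w, 'k::real_normed_field) fun_data \<Rightarrow> (nat \<Rightarrow> 'w) \<Rightarrow> bool"
  where "fixes_topology \<nu> K x \<longleftrightarrow>
    (\<exists>C>0. \<forall>f \<in> Fnu norm \<nu> K.
      Fnu_norm norm \<nu> K f \<le> C * (SUP n. norm (op_T K f (x n)) * \<nu> (x n)))"

text \<open>The standing assumptions for the values \<open>Y = \<K>\<close> and all Banach spaces \<open>Y = E\<close>, together
  with the hypotheses on every pair \<open>F(\<Omega>)\<close>, \<open>F(\<Omega>,E)\<close>. The Banach spaces range over all
  subspaces of the ambient vector space \<open>('e, s)\<close>, which is arbitrary, with all complete norms
  on them, and over \<open>\<K>\<close> itself (whose data are \<open>K\<close>), so that \<open>\<K>\<close> is covered even if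
  \<open>'e\<close> is small.\<close>

definition admissible_family ::
  "('k::real_or_complex \<Rightarrow> 'e \<Rightarrow> 'e) \<Rightarrow> ('w \<Rightarrow> real) \<Rightarrow> ('o, 'w, 'k) fun_data \<Rightarrow>
   ('e::ab_group_add set \<Rightarrow> ('e \<Rightarrow> real) \<Rightarrow> ('o, 'w, 'e) fun_data) \<Rightarrow> bool"
  where "admissible_family s \<nu> K D \<longleftrightarrow>
    fun_setting (*) UNIV K \<and>
    (\<forall>t. delta (F_space K) t \<in> dual (fscale (*)) (top_F K)) \<and>
    eps_into_compatible K (*) UNIV norm K \<and> generator \<nu> K norm K \<and>
    consistent K (*) UNIV norm K \<and> strong_family K (*) UNIV norm K \<and>
    (\<forall>E N. banach_space s E N \<longrightarrow>
      fun_setting s E (D E N) \<and>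
      eps_into_compatible K s E N (D E N) \<and> generator \<nu> K N (D E N) \<and>
      consistent K s E N (D E N) \<and> strong_family K s E N (D E N))"

end

theory Submission
  imports Defs
begin

text \<open>
  Write \<open>V = \<F>\<nu>(\<Omega>)\<close> and \<open>e\<^sub>n = \<nu>(x\<^sub>n) T\<close> at \<open>x\<^sub>n\<close>, so that the norm of \<open>V\<close> is equivalent to
  \<open>sup\<^sub>n \<bar>e\<^sub>n f\<bar>\<close>. For a functional \<open>\<phi>\<close> on \<open>F(\<Omega>)\<close> with \<open>\<bar>\<phi> f\<bar> \<le> m \<parallel>f\<parallel>\<close> on \<open>V\<close>, the sets
  \<open>\<bar>\<phi> f\<bar> < m C \<bar>e\<^sub>n f\<bar> + \<epsilon>\<close> are open and cover the compact unit ball of \<open>V\<close>; hence finitely many \<open>e\<^sub>n\<close>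
  suffice, and by Hahn-Banach in finite dimensions \<open>\<phi>\<close> is within \<open>\<epsilon>\<close> of a combination of the \<open>e\<^sub>n\<close>
  with coefficients of \<open>\<ell>\<^sup>1\<close>-norm at most \<open>m C\<close>. Iteration gives \<open>\<phi> = \<Sum>\<^sub>n b\<^sub>n e\<^sub>n\<close> on \<open>V\<close> with \<open>\<ell>\<^sup>1\<close>-norm
  at most \<open>2 m C\<close>.

  If the canonical map for seminorms \<open>p \<le> q\<close> is \<open>\<Sum>\<^sub>j a\<^sub>j \<otimes> y\<^sub>j\<close>, expand every \<open>a\<^sub>j\<close> in this way with coefficients
  \<open>b\<^sub>j\<^sub>n\<close>. Then \<open>\<Sum>\<^sub>j p(y\<^sub>j) \<bar>b\<^sub>j\<^sub>n\<bar>\<close> is a summable sequence in \<open>n\<close> that dominates the coefficients of all \<open>\<mu>\<close> with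
  \<open>\<bar>\<mu>\<bar> \<le> p\<close>, and also \<open>p\<close> itself. A weighted sum over a countable fundamental system of seminorms gives
  \<open>\<lambda>\<close>, because bounded sets in the strong dual are equicontinuous. For \<open>\<epsilon>\<^sub>n\<close> take the square roots of the
  tails of \<open>\<lambda>\<close>, so that \<open>\<lambda>\<^sub>n / \<epsilon>\<^sub>n\<close> is still summable.
\<close>

section \<open>Scalars\<close>

text \<open>Algebra alone fixes the rationals; being additive and isometric, \<open>\<phi>\<close>
  is continuous, and the rationals are dense in the reals.\<close>

lemma isometric_hom_of_real:
  fixes \<phi> :: "'k::real_normed_field \<Rightarrow> 'l::real_normed_field"
  assumes "bij \<phi>" and add: "\<And>a b. \<phi> (a + b) = \<phi> a + \<phi> b"
    and mult: "\<And>a b. \<phi> (a * b) = \<phi> a * \<phi> b" and norm: "\<And>a. norm (\<phi> a) = norm a"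
  shows "\<phi> (of_real r) = of_real r"
proof -
  have "\<phi> 1 * \<phi> 1 = \<phi> 1" using mult[of 1 1] by simp
  moreover have "\<phi> 1 \<noteq> 0" using norm[of 1] by auto
  ultimately have one: "\<phi> 1 = 1" by simp
  have zero: "\<phi> 0 = 0" using norm[of 0] by simp
  have minus: "\<phi> (- a) = - \<phi> a" for a using add[of a "- a"] zero by (simp add: eq_neg_iff_add_eq_0 add.commute)
  have nat: "\<phi> (of_nat n) = of_nat n" for n by (induction n) (auto simp: zero one add)
  have int: "\<phi> (of_int n) = of_int n" for n
    by (cases n rule: int_cases2) (auto simp: nat minus)
  have inv: "\<phi> (inverse a) = inverse (\<phi> a)" for a
  proof (cases "a = 0")
    case False
    then have "\<phi> a * \<phi> (inverse a) = 1" using mult[of a "inverse a"] one by simp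
    then show ?thesis by (metis inverse_unique)
  qed (simp add: zero)
  have rat: "\<phi> (of_real (of_rat q)) = of_real (of_rat q)" for q
    by (cases q) (simp add: of_rat_rat divide_inverse mult inv int)
  have "norm (\<phi> (of_real r) - of_real r) \<le> e" if e: "0 < e" for e :: real
  proof -
    obtain q where q: "r - e / 2 < of_rat q" "of_rat q < r"
      using of_rat_dense[of "r - e / 2" r] e by auto
    have "norm (\<phi> (of_real r) - of_real (of_rat q)) = norm (\<phi> (of_real r - of_real (of_rat q)))"
      by (simp add: rat minus add diff_conv_add_uminus del: add_uminus_conv_diff)
    also have "\<dots> = \<bar>r - of_rat q\<bar>" unfolding norm by (metis norm_of_real of_real_diff)
    finally have 1: "norm (\<phi> (of_real r) - of_real (of_rat q)) < e / 2" using q by auto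
    have "norm (of_real (of_rat q) - of_real r :: 'l) = \<bar>of_rat q - r\<bar>"
      by (metis norm_of_real of_real_diff)
    then have 2: "norm (of_real (of_rat q) - of_real r :: 'l) < e / 2" using q by auto
    show ?thesis
      using norm_triangle_ineq[of "\<phi> (of_real r) - of_real (of_rat q)" "of_real (of_rat q) - of_real r"] 1 2
      by auto
  qed
  then have "norm (\<phi> (of_real r) - of_real r) \<le> 0" by (meson field_le_epsilon add_increasing order_refl dense_ge)
  then show ?thesis by simp
qed

text \<open>\<open>re\<close> plays the role of the real part, and \<open>i\<close> that of the imaginary unit; in the real case
  \<open>i\<close> is superfluous.\<close>

lemma real_or_complex_re:
  obtains re :: "'k::real_or_complex \<Rightarrow> real" and i :: 'k
  where "\<And>a b. re (a + b) = re a + re b" "\<And>r a. re (of_real r * a) = r * re a"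
    "\<And>a. re a \<le> norm a" "\<And>a. \<exists>u. norm u = 1 \<and> re (u * a) = norm a"
    "\<And>a. \<exists>r t. a = of_real r + of_real t * i"
    "\<And>l :: 'k \<Rightarrow> real. (\<And>a b. l (a + b) = l a + l b) \<Longrightarrow> (\<And>r a. l (of_real r * a) = r * l a) \<Longrightarrow>
       \<exists>b. \<forall>a. l a = re (b * a)"
  using real_or_complex[where 'a='k]
proof (elim disjE exE conjE)
  fix \<phi> :: "'k \<Rightarrow> real"
  assume real: "bij \<phi>" "\<forall>a b. \<phi> (a + b) = \<phi> a + \<phi> b"
    "\<forall>a b. \<phi> (a * b) = \<phi> a * \<phi> b" "\<forall>a. norm (\<phi> a) = norm a"
  note real = real(1) real(2-4)[rule_format]
  note of_real = isometric_hom_of_real[OF real(1,2,3,4), simplified]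
  have eq: "a = of_real (\<phi> a)" for a
    by (rule injD[OF bij_is_inj[OF real(1)]]) (simp add: of_real)
  show ?thesis
  proof (rule that[of \<phi> 0])
    show "\<phi> a \<le> norm a" for a using real(4)[of a] by simp
    show "\<exists>u. norm u = 1 \<and> \<phi> (u * a) = norm a" for a
    proof (cases "\<phi> a \<ge> 0")
      case True
      then show ?thesis using real(4)[of a] by (intro exI[of _ 1]) simp
    next
      case False
      then show ?thesis using real(4)[of a] real(3)[of "-1" a] of_real[of "-1"]
        by (intro exI[of _ "-1"]) (simp add: abs_if)
    qed
    show "\<exists>r t. a = of_real r + of_real t * 0" for a :: 'k
      by (intro exI[of _ "\<phi> a"] exI[of _ 0]) (simp flip: eq)
    show "\<exists>b. \<forall>a. l a = \<phi> (b * a)"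
      if "\<And>a b. l (a + b) = l a + l b" "\<And>r a. l (of_real r * a) = r * l a" for l :: "'k \<Rightarrow> real"
    proof (intro exI[of _ "of_real (l 1)"] allI)
      fix a
      have "l a = l (of_real (\<phi> a) * 1)" unfolding mult_1_right by (rule arg_cong[OF eq])
      then show "l a = \<phi> (of_real (l 1) * a)" unfolding that(2) by (simp add: real(3) of_real)
    qed
  qed (auto simp: real(2,3) of_real)
next
  fix \<phi> :: "'k \<Rightarrow> complex"
  assume complex: "bij \<phi>" "\<forall>a b. \<phi> (a + b) = \<phi> a + \<phi> b"
    "\<forall>a b. \<phi> (a * b) = \<phi> a * \<phi> b" "\<forall>a. norm (\<phi> a) = norm a"
  note complex = complex(1) complex(2-4)[rule_format]
  note of_real = isometric_hom_of_real[OF complex(1,2,3,4)]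
  define i where "i = inv \<phi> \<i>"
  have i: "\<phi> i = \<i>" unfolding i_def using complex(1) by (simp add: bij_is_surj surj_f_inv_f)
  have eq: "a = of_real (Re (\<phi> a)) + of_real (Im (\<phi> a)) * i" for a
  proof -
    have "\<phi> (of_real (Re (\<phi> a)) + of_real (Im (\<phi> a)) * i) = \<phi> a"
      by (simp add: complex(2,3) of_real i complex_eq_iff)
    then show ?thesis using injD[OF bij_is_inj[OF complex(1)]] by metis
  qed
  show ?thesis
  proof (rule that[of "\<lambda>a. Re (\<phi> a)" i])
    show "Re (\<phi> a) \<le> norm a" for a using complex_Re_le_cmod[of "\<phi> a"] complex(4)[of a] by simp
    show "\<exists>u. norm u = 1 \<and> Re (\<phi> (u * a)) = norm a" for a
    proof (cases "a = 0")
      case False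
      then have n: "norm (\<phi> a) \<noteq> 0" using complex(4) by simp
      define w where "w = cnj (\<phi> a) / norm (\<phi> a)"
      define u where "u = inv \<phi> w"
      have u: "\<phi> u = w" unfolding u_def using complex(1) by (simp add: bij_is_surj surj_f_inv_f)
      have "norm w = 1" using n by (simp add: w_def norm_divide)
      moreover have "w * \<phi> a = norm (\<phi> a)"
        using n by (simp add: w_def field_simps complex_norm_square[symmetric] power2_eq_square)
      ultimately show ?thesis using u complex(4)[of u] by (intro exI[of _ u]) (auto simp: complex(3,4))
    next
      case True
      have "\<phi> 0 = 0" using complex(4)[of 0] by simp
      then show ?thesis using True by (intro exI[of _ 1]) simp
    qed
    show "\<exists>r t. a = of_real r + of_real t * i" for a using eq by blast
    show "\<exists>b. \<forall>a. l a = Re (\<phi> (b * a))"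
      if "\<And>a b. l (a + b) = l a + l b" "\<And>r a. l (of_real r * a) = r * l a" for l :: "'k \<Rightarrow> real"
    proof -
      \<comment> \<open>The multiplier is the preimage of \<open>l 1 - \<i> * l i\<close>; the minus
        sign compensates \<open>\<i> * \<i> = - 1\<close> in the real part of the product.\<close>
      have 1: "\<phi> (inv \<phi> (Complex (l 1) (- l i))) = Complex (l 1) (- l i)"
        using complex(1) by (simp add: bij_is_surj surj_f_inv_f)
      have 2: "l a = Re (\<phi> a) * l 1 + Im (\<phi> a) * l i" for a
      proof -
        have "l a = l (of_real (Re (\<phi> a)) * 1 + of_real (Im (\<phi> a)) * i)"
          unfolding mult_1_right by (rule arg_cong[OF eq])
        then show ?thesis unfolding that by simp
      qed
      show ?thesis
      proof (intro exI allI)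
        show "l a = Re (\<phi> (inv \<phi> (Complex (l 1) (- l i)) * a))" for a
          unfolding 2[of a] by (simp add: complex(3) 1)
      qed
    qed
  qed (auto simp: complex(2,3) of_real)
qed

text \<open>Completeness of \<open>'k\<close> is not part of its sort, so it is imported: the image
  series converges in the Banach space \<open>'l\<close>, and the preimage of its sum is the sum
  wanted.\<close>

lemma summable_norm_cancel_isometric:
  fixes \<phi> :: "'k::real_normed_vector \<Rightarrow> 'l::banach" and a :: "nat \<Rightarrow> 'k"
  assumes "bij \<phi>" and add: "\<And>a b. \<phi> (a + b) = \<phi> a + \<phi> b"
    and norm: "\<And>a. norm (\<phi> a) = norm a" and "summable (\<lambda>n. norm (a n))"
  shows "summable a"
proof -
  have zero: "\<phi> 0 = 0" using norm[of 0] by simp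
  have minus: "\<phi> (- a) = - \<phi> a" for a
    using add[of a "- a"] zero by (simp add: eq_neg_iff_add_eq_0 add.commute)
  have sum: "\<phi> (sum a {..<n}) = (\<Sum>k<n. \<phi> (a k))" for n by (induction n) (auto simp: zero add)
  have "summable (\<lambda>n. \<phi> (a n))"
    by (rule summable_norm_cancel) (use assms in \<open>simp add: norm\<close>)
  then obtain c where c: "(\<lambda>n. \<phi> (a n)) sums c" by (auto simp: summable_def)
  define d where "d = inv \<phi> c"
  have d: "\<phi> d = c" unfolding d_def using assms(1) by (simp add: bij_is_surj surj_f_inv_f)
  have "norm (sum a {..<n} - d) = norm ((\<Sum>k<n. \<phi> (a k)) - c)" for n
    by (metis add d diff_conv_add_uminus minus norm sum)
  then have "(\<lambda>n. norm (sum a {..<n} - d)) \<longlonglongrightarrow> 0"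
    using c by (simp add: sums_def LIM_zero_iff tendsto_norm_zero_iff)
  then have "a sums d" by (simp add: sums_def LIM_zero_iff tendsto_norm_zero_iff)
  then show ?thesis by (rule sums_summable)
qed

lemma summable_norm_real_or_complex:
  fixes a :: "nat \<Rightarrow> 'k::real_or_complex"
  assumes "summable (\<lambda>n. norm (a n))"
  shows "summable a"
  using real_or_complex[where 'a='k]
proof (elim disjE exE conjE)
  show ?thesis if "bij \<phi>" "\<forall>a b. \<phi> (a + b) = \<phi> a + \<phi> b" "\<forall>a. norm (\<phi> a) = norm a" for \<phi> :: "'k \<Rightarrow> real"
    using summable_norm_cancel_isometric[of \<phi> a] that assms by simp
  show ?thesis if "bij \<phi>" "\<forall>a b. \<phi> (a + b) = \<phi> a + \<phi> b" "\<forall>a. norm (\<phi> a) = norm a" for \<phi> :: "'k \<Rightarrow> complex"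
    using summable_norm_cancel_isometric[of \<phi> a] that assms by simp
qed

section \<open>Sublinear functionals\<close>

text \<open>The scalar multiplication is a parameter because the space in use consists of sequences
  over \<open>'k\<close>, viewed as a real vector space. The inequality for scaling becomes an
  equality when it is applied to \<open>1 / r\<close> as well
  (\<open>sublinear_scale\<close>).\<close>

definition sublinear :: "(real \<Rightarrow> 'a \<Rightarrow> 'a) \<Rightarrow> ('a::ab_group_add \<Rightarrow> real) \<Rightarrow> bool"
  where "sublinear s p \<longleftrightarrow> (\<forall>x y. p (x + y) \<le> p x + p y) \<and> (\<forall>r>0. \<forall>x. p (s r x) \<le> r * p x)"

lemma sublinear_add: "sublinear s p \<Longrightarrow> p (x + y) \<le> p x + p y"
  by (simp add: sublinear_def)

lemma sublinear_scale:
  assumes "vector_space s" "sublinear s p" "0 < r"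
  shows "p (s r x) = r * p x"
proof -
  interpret vector_space s by fact
  have le: "p (s r x) \<le> r * p x" if "0 < r" for r x
    using assms(2) that unfolding sublinear_def by blast
  have "p (s r x) \<le> r * p x" "r * p x \<le> p (s r x)"
    using le[of "1 / r" "s r x"] le[of r x] assms(3) by (simp_all add: field_simps)
  then show ?thesis by simp
qed

lemma sublinear_zero:
  assumes "vector_space s" "sublinear s p"
  shows "p 0 = 0"
proof -
  interpret vector_space s by fact
  show ?thesis using sublinear_scale[OF assms, of 2 0] by simp
qed

lemma sublinear_neg_le:
  assumes "vector_space s" "sublinear s p"
  shows "- p (- x) \<le> p x"
  using sublinear_add[OF assms(2), of x "- x"] sublinear_zero[OF assms] by simp

text \<open>Covers both infima used below, one over a ray and one over a subspace. The conditions
  express that \<open>h\<close> is subadditive and positively homogeneous jointly in point and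
  parameter; the minorant \<open>m\<close> keeps the infimum finite.\<close>

lemma sublinear_INF:
  assumes "I \<noteq> {}"
    and add: "\<And>x y i j. i \<in> I \<Longrightarrow> j \<in> I \<Longrightarrow> \<exists>k\<in>I. h (x + y) k \<le> h x i + h y j"
    and scale: "\<And>x i r. i \<in> I \<Longrightarrow> 0 < r \<Longrightarrow> \<exists>k\<in>I. h (s r x) k \<le> r * h x i"
    and bdd: "\<And>x i. i \<in> I \<Longrightarrow> m x \<le> h x i"
  shows "sublinear s (\<lambda>x. INF i\<in>I. h x i)"
  unfolding sublinear_def
proof (intro conjI allI impI)
  have lower: "(INF i\<in>I. h x i) \<le> h x i" if "i \<in> I" for x i
    using that bdd by (intro cINF_lower) (auto intro!: bdd_belowI)
  fix x y
  have "(INF i\<in>I. h (x + y) i) - h y j \<le> (INF i\<in>I. h x i)" if j: "j \<in> I" for j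
  proof (rule cINF_greatest[OF assms(1)])
    fix i assume "i \<in> I"
    then obtain k where "k \<in> I" "h (x + y) k \<le> h x i + h y j" using add j by blast
    then show "(INF i\<in>I. h (x + y) i) - h y j \<le> h x i" using lower[of k "x + y"] by simp
  qed
  then have "(INF i\<in>I. h (x + y) i) - (INF i\<in>I. h x i) \<le> (INF i\<in>I. h y i)"
    by (intro cINF_greatest[OF assms(1)]) (simp add: algebra_simps)
  then show "(INF i\<in>I. h (x + y) i) \<le> (INF i\<in>I. h x i) + (INF i\<in>I. h y i)" by simp
next
  have lower: "(INF i\<in>I. h x i) \<le> h x i" if "i \<in> I" for x i
    using that bdd by (intro cINF_lower) (auto intro!: bdd_belowI)
  fix r x assume r: "(0::real) < r"
  have "(INF i\<in>I. h (s r x) i) / r \<le> (INF i\<in>I. h x i)"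
  proof (rule cINF_greatest[OF assms(1)])
    fix i assume "i \<in> I"
    then obtain k where "k \<in> I" "h (s r x) k \<le> r * h x i" using scale r by blast
    then show "(INF i\<in>I. h (s r x) i) / r \<le> h x i"
      using lower[of k "s r x"] r by (simp add: field_simps)
  qed
  then show "(INF i\<in>I. h (s r x) i) \<le> r * (INF i\<in>I. h x i)" using r by (simp add: field_simps)
qed

text \<open>The new functional is \<open>x \<mapsto> inf\<^sub>t\<^sub>\<ge>\<^sub>0 (p (x + t v) - t p v)\<close>.\<close>

lemma sublinear_make_odd_at:
  assumes vs: "vector_space s" and p: "sublinear s p"
  obtains p' where "sublinear s p'" "\<And>x. p' x \<le> p x" "p' (- v) \<le> - p' v"
proof
  interpret vector_space s by fact
  define h where "h x t = p (x + s t v) - t * p v" for x t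
  let ?p = "\<lambda>x. INF t\<in>{0..}. h x t"
  \<comment> \<open>Subadditivity at \<open>s t v = (x + s t v) + (- x)\<close> bounds
    \<open>h\<close> below, uniformly in \<open>t\<close>.\<close>
  have bdd: "- p (- x) \<le> h x t" if "t \<in> {0..}" for x t
  proof (cases "t = 0")
    case True
    then show ?thesis using sublinear_neg_le[OF vs p, of x] by (simp add: h_def)
  next
    case False
    then have "p (s t v) = t * p v" using sublinear_scale[OF vs p] that by auto
    then show ?thesis using sublinear_add[OF p, of "x + s t v" "- x"] by (simp add: h_def)
  qed
  have lower: "?p x \<le> h x t" if "0 \<le> t" for x t
    using that bdd by (intro cINF_lower) (auto intro!: bdd_belowI)
  show "sublinear s ?p"
  proof (rule sublinear_INF)
    fix x y :: 'a and t u :: real assume "t \<in> {0..}" "u \<in> {0..}"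
    then show "\<exists>k\<in>{0..}. h (x + y) k \<le> h x t + h y u"
      using sublinear_add[OF p, of "x + s t v" "y + s u v"]
      by (intro bexI[of _ "t + u"]) (auto simp: h_def scale_left_distrib algebra_simps)
  next
    fix x and t r :: real assume "t \<in> {0..}" "0 < r"
    then show "\<exists>k\<in>{0..}. h (s r x) k \<le> r * h x t"
      using sublinear_scale[OF vs p, of r "x + s t v"]
      by (intro bexI[of _ "r * t"]) (auto simp: h_def scale_right_distrib algebra_simps)
  qed (use bdd in auto)
  show le: "?p x \<le> p x" for x using lower[of 0 x] by (simp add: h_def)
  \<comment> \<open>The parameter \<open>t = 1\<close> cancels \<open>- v\<close>, so
    \<open>?p (- v) \<le> p 0 - p v = - p v\<close>, and \<open>?p v \<le> p v\<close>.\<close>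
  show "?p (- v) \<le> - ?p v"
    using lower[of 1 "- v"] le[of v] sublinear_zero[OF vs p] by (simp add: h_def)
qed

text \<open>The vectors are treated one after another. Decreasing the functional further keeps the
  inequalities obtained earlier, since \<open>p' w\<close> and \<open>p' (- w)\<close> only get
  smaller.\<close>

lemma sublinear_make_odd_on:
  assumes vs: "vector_space s" and p: "sublinear s p" and "finite A"
  shows "\<exists>p'. sublinear s p' \<and> (\<forall>x. p' x \<le> p x) \<and> (\<forall>v\<in>A. p' (- v) \<le> - p' v)"
  using \<open>finite A\<close>
proof induction
  case empty
  then show ?case using p by auto
next
  case (insert v A)
  then obtain p1 where p1: "sublinear s p1" "\<And>x. p1 x \<le> p x" "\<And>v. v \<in> A \<Longrightarrow> p1 (- v) \<le> - p1 v"
    by blast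
  obtain p2 where p2: "sublinear s p2" "\<And>x. p2 x \<le> p1 x" "p2 (- v) \<le> - p2 v"
    using sublinear_make_odd_at[OF vs p1(1)] by metis
  have "p2 (- w) \<le> - p2 w" if "w \<in> A" for w
    using p2(2)[of w] p2(2)[of "- w"] p1(3)[OF that] by linarith
  then show ?case using p2(1,3) order_trans[OF p2(2) p1(2)] by blast
qed

context
  fixes s :: "real \<Rightarrow> 'a::ab_group_add \<Rightarrow> 'a" and p
  assumes vs: "vector_space s" and p: "sublinear s p"
begin

interpretation vector_space s by (rule vs)

lemma sublinear_odd_iff: "p (- x) \<le> - p x \<longleftrightarrow> p (- x) = - p x"
  using sublinear_neg_le[OF vs p, of "- x"] by auto

text \<open>Subadditivity applied to \<open>y = (x + y) + (- x)\<close> gives the reverse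
  inequality, so oddness at one summand suffices.\<close>

lemma sublinear_odd_add:
  assumes "p (- x) = - p x"
  shows "p (x + y) = p x + p y"
  using sublinear_add[OF p, of x y] sublinear_add[OF p, of "x + y" "- x"] assms by simp

lemma sublinear_odd_scale:
  assumes "p (- x) = - p x"
  shows "p (s r x) = r * p x"
proof -
  consider "r < 0" | "r = 0" | "r > 0" by linarith
  then show ?thesis
  proof cases
    case 1
    then show ?thesis using sublinear_scale[OF vs p, of "- r" "- x"] assms by simp
  qed (auto simp: sublinear_scale[OF vs p] sublinear_zero[OF vs p])
qed

text \<open>Additivity and homogeneity carry oddness over to linear combinations. Hence oddness at a
  real basis is enough to make \<open>p\<close> linear.\<close>

lemma subspace_sublinear_odd: "subspace {x. p (- x) = - p x}"
proof (rule subspaceI)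
  show "x + y \<in> {x. p (- x) = - p x}" if "x \<in> {x. p (- x) = - p x}" "y \<in> {x. p (- x) = - p x}" for x y
    using that sublinear_odd_add[of x y] sublinear_odd_add[of "- x" "- y"] by simp
  show "s c x \<in> {x. p (- x) = - p x}" if "x \<in> {x. p (- x) = - p x}" for x c
    using that sublinear_odd_scale[of x c] sublinear_odd_scale[of x "- c"] by simp
qed (simp add: sublinear_zero[OF vs p])

lemma sublinear_odd_sum:
  assumes "\<And>i. i \<in> I \<Longrightarrow> p (- g i) = - p (g i)"
  shows "p (sum g I) = (\<Sum>i\<in>I. p (g i))"
  using assms
proof (induction I rule: infinite_finite_induct)
  case (insert i I)
  then show ?case using sublinear_odd_add[of "g i" "sum g I"] by simp
qed (simp_all add: sublinear_zero[OF vs p])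

end

section \<open>Hahn-Banach decomposition in finitely many coordinates\<close>

lemma linear_onD:
  assumes "linear_on s t V u"
  shows "x \<in> V \<Longrightarrow> y \<in> V \<Longrightarrow> u (x + y) = u x + u y" "x \<in> V \<Longrightarrow> u (s c x) = t c (u x)"
  using assms by (auto simp: linear_on_def)

lemma seminorm_onD:
  assumes "seminorm_on s V p"
  shows "x \<in> V \<Longrightarrow> y \<in> V \<Longrightarrow> p (x + y) \<le> p x + p y" "x \<in> V \<Longrightarrow> p (s c x) = norm c * p x"
  using assms by (auto simp: seminorm_on_def)

text \<open>The Hahn-Banach theorem is only needed on \<open>\<K>\<^sup>M\<close>, for the sublinear functional
  \<open>z \<mapsto> inf\<^sub>f (Q (z + e f) + \<epsilon> N f - re (\<phi> f))\<close> where \<open>Q\<close> is \<open>A\<close> times the maximum norm.\<close>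

lemma hahn_banach_decomposition:
  fixes s :: "'k::real_or_complex \<Rightarrow> 'v::ab_group_add \<Rightarrow> 'v" and \<phi> :: "'v \<Rightarrow> 'k" and e :: "nat \<Rightarrow> 'v \<Rightarrow> 'k"
  assumes vs: "vector_space s" and V: "module.subspace s V" and N: "seminorm_on s V N"
    and \<phi>: "linear_on s (*) V \<phi>" and e: "\<And>n. linear_on s (*) V (e n)"
    and "0 \<le> A" "0 \<le> \<epsilon>" and bound: "\<And>f. f \<in> V \<Longrightarrow> \<exists>n<M. norm (\<phi> f) \<le> A * norm (e n f) + \<epsilon> * N f"
  obtains b where "(\<Sum>n<M. norm (b n)) \<le> A"
    "\<And>f. f \<in> V \<Longrightarrow> norm (\<phi> f - (\<Sum>n<M. b n * e n f)) \<le> \<epsilon> * N f"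
proof -
  interpret vector_space s by (rule vs)
  obtain re :: "'k \<Rightarrow> real" and i :: 'k where
    re_add: "\<And>a b. re (a + b) = re a + re b" and re_scale: "\<And>r a. re (of_real r * a) = r * re a"
    and re_le: "\<And>a. re a \<le> norm a" and re_norm: "\<And>a. \<exists>u. norm u = 1 \<and> re (u * a) = norm a"
    and span: "\<And>a. \<exists>r t. a = of_real r + of_real t * i"
    and rep: "\<And>l :: 'k \<Rightarrow> real. (\<And>a b. l (a + b) = l a + l b) \<Longrightarrow>
      (\<And>r a. l (of_real r * a) = r * l a) \<Longrightarrow> \<exists>b. \<forall>a. l a = re (b * a)"
    by (rule real_or_complex_re) blast
  have re_0: "re 0 = 0" using re_scale[of 0 0] by simp
  have re_minus: "re (- a) = - re a" for a using re_add[of a "- a"] re_0 by simp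
  have re_sum: "re (sum g I) = (\<Sum>n\<in>I. re (g n))" for g :: "nat \<Rightarrow> 'k" and I
    by (induction I rule: infinite_finite_induct) (auto simp: re_0 re_add)
  define sc :: "real \<Rightarrow> (nat \<Rightarrow> 'k) \<Rightarrow> nat \<Rightarrow> 'k" where "sc = fscale scaleR"
  have sc: "vector_space sc" unfolding sc_def
    by (intro vector_space_fscale) (rule real_vector.vector_space_axioms)
  interpret sc: vector_space sc by (rule sc)
  have sc_apply: "sc r z n = of_real r * z n" for r z n
    by (simp add: sc_def fscale_def scaleR_conv_of_real)
  \<comment> \<open>The bound at \<open>f = 0\<close> already exhibits an index below
    \<open>M\<close>, so the maximum in \<open>Q\<close> is over a nonempty set.\<close>
  have "0 < M" using bound[OF subspace_0[OF V]] by auto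
  define Q where "Q z = A * Max ((\<lambda>n. norm (z n)) ` {..<M})" for z :: "nat \<Rightarrow> 'k"
  have Q_ge: "A * norm (z n) \<le> Q z" if "n < M" for z n
    unfolding Q_def using that \<open>0 \<le> A\<close> by (intro mult_left_mono) auto
  have Q_le: "\<exists>n<M. Q z = A * norm (z n)" for z
  proof -
    have "Max ((\<lambda>n. norm (z n)) ` {..<M}) \<in> (\<lambda>n. norm (z n)) ` {..<M}"
      using \<open>0 < M\<close> by (intro Max_in) auto
    then show ?thesis unfolding Q_def by auto
  qed
  have Q_add: "Q (z + w) \<le> Q z + Q w" for z w
  proof -
    obtain n where n: "n < M" "Q (z + w) = A * norm ((z + w) n)" using Q_le by blast
    have "A * norm ((z + w) n) \<le> A * (norm (z n) + norm (w n))"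
      using \<open>0 \<le> A\<close> by (intro mult_left_mono) (auto simp: norm_triangle_ineq)
    then show ?thesis using n Q_ge[of n z] Q_ge[of n w] by (simp add: distrib_left)
  qed
  have Q_scale: "Q (sc r z) \<le> r * Q z" if "0 < r" for r z
  proof -
    obtain n where n: "n < M" "Q (sc r z) = A * norm (sc r z n)" using Q_le by blast
    then show ?thesis using that Q_ge[of n z] by (simp add: sc_apply norm_mult)
  qed
  \<comment> \<open>Coordinates from \<open>M\<close> on are cut off, because \<open>p'\<close>
    below is only identified on vectors supported below \<open>M\<close>.\<close>
  define E where "E f n = (if n < M then e n f else 0)" for f n
  have E_add: "E (f + g) = E f + E g" if "f \<in> V" "g \<in> V" for f g
    using linear_onD(1)[OF e that] by (auto simp: E_def fun_eq_iff)
  have E_scale: "E (s (of_real r) f) = sc r (E f)" if "f \<in> V" for f r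
    using linear_onD(2)[OF e that] by (auto simp: E_def fun_eq_iff sc_apply)
  have bound': "norm (\<phi> f) \<le> Q (E f) + \<epsilon> * N f" if "f \<in> V" for f
  proof -
    obtain n where "n < M" "norm (\<phi> f) \<le> A * norm (e n f) + \<epsilon> * N f" using bound[OF \<open>f \<in> V\<close>] by blast
    then show ?thesis using Q_ge[of n "E f"] by (simp add: E_def)
  qed
  define h where "h z f = Q (z + E f) + \<epsilon> * N f - re (\<phi> f)" for z f
  define p where "p z = (INF f\<in>V. h z f)" for z
  \<comment> \<open>This is where the bound on \<open>\<phi>\<close> enters:
    \<open>re (\<phi> f) \<le> Q (E f) + \<epsilon> * N f\<close>, while
    \<open>Q (E f) \<le> Q (z + E f) + Q (- z)\<close>.\<close>
  have bdd: "- Q (- z) \<le> h z f" if "f \<in> V" for z f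
    using bound'[OF that] Q_add[of "z + E f" "- z"] re_le[of "\<phi> f"] by (simp add: h_def)
  have p_le: "p z \<le> h z f" if "f \<in> V" for z f
    unfolding p_def using that bdd by (intro cINF_lower) (auto intro!: bdd_belowI)
  have p: "sublinear sc p"
    unfolding p_def
  proof (rule sublinear_INF)
    show "V \<noteq> {}" using subspace_0[OF V] by auto
  next
    fix z w f g assume *: "f \<in> V" "g \<in> V"
    have "h (z + w) (f + g) \<le> h z f + h w g"
      using Q_add[of "z + E f" "w + E g"] linear_onD(1)[OF \<phi> *] seminorm_onD(1)[OF N *]
        mult_left_mono[OF seminorm_onD(1)[OF N *] \<open>0 \<le> \<epsilon>\<close>]
      by (simp add: h_def E_add[OF *] re_add algebra_simps)
    then show "\<exists>k\<in>V. h (z + w) k \<le> h z f + h w g" using subspace_add[OF V *] by blast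
  next
    fix z f and r :: real assume *: "f \<in> V" "0 < r"
    have "h (sc r z) (s (of_real r) f) \<le> r * h z f"
      using Q_scale[OF *(2), of "z + E f"] linear_onD(2)[OF \<phi> *(1)] seminorm_onD(2)[OF N *(1)] *(2)
      by (simp add: h_def E_scale[OF *(1)] re_scale sc.scale_right_distrib algebra_simps)
    then show "\<exists>k\<in>V. h (sc r z) k \<le> r * h z f" using subspace_scale[OF V *(1)] by blast
  qed (use bdd in auto)
  define unit :: "nat \<Rightarrow> 'k \<Rightarrow> nat \<Rightarrow> 'k" where "unit n c m = (if m = n then c else 0)" for n c m
  have unit_add: "unit n (c + d) = unit n c + unit n d" for n c d
    by (auto simp: unit_def fun_eq_iff)
  have unit_scale: "unit n (of_real r * c) = sc r (unit n c)" for n c r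
    by (auto simp: unit_def sc_apply fun_eq_iff)
  \<comment> \<open>The vectors \<open>unit n 1\<close> and \<open>unit n i\<close> span the vectors
    supported below \<open>M\<close> over the reals, so finitely many corrections make
    \<open>p'\<close> real-linear there.\<close>
  obtain p' where p': "sublinear sc p'" "\<And>z. p' z \<le> p z"
    and odd_basis: "\<And>n w. n < M \<Longrightarrow> w \<in> {1, i} \<Longrightarrow> p' (- unit n w) \<le> - p' (unit n w)"
    using sublinear_make_odd_on[OF sc p, of "case_prod unit ` ({..<M} \<times> {1, i})"] by fastforce
  note odd_rules = sublinear_odd_iff[OF sc p'(1)] sublinear_odd_add[OF sc p'(1)]
    sublinear_odd_scale[OF sc p'(1)] sublinear_odd_sum[OF sc p'(1)]
  have odd: "p' (- unit n c) = - p' (unit n c)" if "n < M" for n c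
  proof -
    obtain r t where "c = of_real r + of_real t * i" using span by blast
    then have *: "unit n c = sc r (unit n 1) + sc t (unit n i)"
      by (simp flip: unit_scale unit_add)
    have "unit n 1 \<in> {x. p' (- x) = - p' x}" "unit n i \<in> {x. p' (- x) = - p' x}"
      using odd_basis that odd_rules(1) by auto
    then have "unit n c \<in> {x. p' (- x) = - p' x}"
      unfolding * by (intro sc.subspace_add sc.subspace_scale subspace_sublinear_odd[OF sc p'(1)])
    then show ?thesis by simp
  qed
  have "\<exists>b. n < M \<longrightarrow> (\<forall>c. p' (unit n c) = re (b * c))" for n
  proof (cases "n < M")
    case True
    have "\<exists>b. \<forall>c. p' (unit n c) = re (b * c)"
      by (rule rep) (auto simp: unit_add unit_scale odd_rules odd True)
    then show ?thesis by blast
  qed auto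
  then obtain b where b: "\<And>n c. n < M \<Longrightarrow> p' (unit n c) = re (b n * c)" by metis
  have p'_eq: "p' z = re (\<Sum>n<M. b n * z n)" if "\<And>n. \<not> n < M \<Longrightarrow> z n = 0" for z
  proof -
    have "(\<Sum>n<M. unit n (z n)) m = z m" for m
    proof -
      have "(\<Sum>n\<in>I. unit n (z n)) m = (\<Sum>n\<in>I. unit n (z n) m)" for I
        by (induction I rule: infinite_finite_induct) auto
      then show ?thesis using that[of m] by (auto simp: unit_def)
    qed
    then have "p' z = p' (\<Sum>n<M. unit n (z n))" by presburger
    also have "\<dots> = (\<Sum>n<M. p' (unit n (z n)))"
      by (rule odd_rules(4)) (auto simp: odd)
    finally show ?thesis by (simp add: b re_sum)
  qed
  show ?thesis
  proof (rule that[of b])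
    \<comment> \<open>Test vector with unimodular coordinates aligned with \<open>b\<close>: there
      \<open>p' z\<close> is the sum of the norms, while \<open>h z 0 = Q z \<le> A\<close>.\<close>
    have "\<forall>n. \<exists>u. norm u = 1 \<and> re (u * b n) = norm (b n)" using re_norm by blast
    then obtain u where u: "\<And>n. norm (u n) = 1" "\<And>n. re (u n * b n) = norm (b n)"
      by (fast dest: choice)
    define z where "z n = (if n < M then u n else 0)" for n
    have "p' z = (\<Sum>n<M. norm (b n))"
      using u(2) by (subst p'_eq) (auto simp: z_def re_sum mult.commute intro!: sum.cong)
    moreover have "p' z \<le> h z 0" using p'(2) p_le subspace_0[OF V] order_trans by blast
    moreover have "E 0 = 0" using E_scale[of 0 0] subspace_0[OF V] by simp
    moreover have "\<phi> 0 = 0" using linear_onD(2)[OF \<phi>, of 0 0] subspace_0[OF V] by simp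
    moreover have "N 0 = 0" using seminorm_onD(2)[OF N, of 0 0] subspace_0[OF V] by simp
    moreover have "Q z \<le> A" using Q_le[of z] u(1) by (auto simp: z_def)
    ultimately show "(\<Sum>n<M. norm (b n)) \<le> A" by (simp add: h_def re_0)
  next
    fix f assume f: "f \<in> V"
    \<comment> \<open>At \<open>z = - E g\<close> the parameter \<open>g\<close> cancels the
      argument of \<open>Q\<close>, leaving \<open>\<epsilon> * N g - re (\<phi> g)\<close> as an
      upper bound for \<open>p'\<close>.\<close>
    have *: "re (\<phi> g - (\<Sum>n<M. b n * e n g)) \<le> \<epsilon> * N g" if g: "g \<in> V" for g
    proof -
      have "p' (- E g) \<le> h (- E g) g" using p'(2) p_le[OF g] order_trans by blast
      moreover have "p' (- E g) = re (- (\<Sum>n<M. b n * e n g))"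
        by (subst p'_eq) (auto simp: E_def sum_negf[symmetric] intro!: arg_cong[of _ _ re] sum.cong)
      moreover have "Q 0 = 0" using Q_le[of 0] by auto
      ultimately show ?thesis using re_add[of "\<phi> g" "- (\<Sum>n<M. b n * e n g)"] by (simp add: h_def)
    qed
    let ?w = "\<phi> f - (\<Sum>n<M. b n * e n f)"
    \<comment> \<open>Rotating \<open>f\<close> by a unimodular scalar turns the bound on the real
      part into one on the norm.\<close>
    obtain u where u: "norm u = 1" "re (u * ?w) = norm ?w" using re_norm by blast
    have "u * ?w = \<phi> (s u f) - (\<Sum>n<M. b n * e n (s u f))"
      using linear_onD(2)[OF \<phi> f] linear_onD(2)[OF e f]
      by (simp add: right_diff_distrib sum_distrib_left mult.left_commute)
    then show "norm ?w \<le> \<epsilon> * N f"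
      using *[OF subspace_scale[OF V f, of u]] seminorm_onD(2)[OF N f, of u] u by simp
  qed
qed

section \<open>Interchange of series\<close>

lemma norm_sums_le:
  fixes f :: "nat \<Rightarrow> 'a::real_normed_vector"
  assumes "f sums x" "g sums y" "\<And>n. norm (f n) \<le> g n"
  shows "norm x \<le> y"
proof (rule LIMSEQ_le)
  show "(\<lambda>n. norm (sum f {..<n})) \<longlonglongrightarrow> norm x"
    using assms(1) by (auto simp: sums_def intro: tendsto_norm)
  show "(\<lambda>n. sum g {..<n}) \<longlonglongrightarrow> y" using assms(2) by (simp add: sums_def)
  show "\<exists>K. \<forall>n\<ge>K. norm (sum f {..<n}) \<le> sum g {..<n}"
    using assms(3) by (auto intro!: exI[of _ 0] sum_norm_le)
qed

text \<open>Partial sums over \<open>n\<close> commute with the sum over \<open>i\<close>, and each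
  stays below \<open>suminf t\<close>.\<close>

lemma nonneg_suminf_swap:
  fixes r :: "nat \<Rightarrow> nat \<Rightarrow> real"
  assumes nonneg: "\<And>i n. 0 \<le> r i n" and r: "\<And>i. summable (r i)" "\<And>i. suminf (r i) \<le> t i" and t: "summable t"
  shows "summable (\<lambda>i. r i n)" "summable (\<lambda>n. \<Sum>i. r i n)" "(\<Sum>n. \<Sum>i. r i n) \<le> suminf t"
proof -
  have le: "(\<Sum>n\<in>I. r i n) \<le> t i" if "finite I" for i I
    using sum_le_suminf[OF r(1) that, of i] nonneg r(2)[of i] by (meson order_trans)
  show s: "summable (\<lambda>i. r i n)" for n
    using le[of "{n}"] nonneg by (intro summable_comparison_test'[OF t, of 0]) auto
  have bound: "(\<Sum>n<m. \<Sum>i. r i n) \<le> suminf t" for m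
  proof -
    have "(\<Sum>n<m. \<Sum>i. r i n) = (\<Sum>i. \<Sum>n<m. r i n)"
      by (rule suminf_sum[symmetric]) (rule s)
    also have "\<dots> \<le> suminf t"
      by (rule suminf_le[OF _ summable_sum t]) (auto intro: s le)
    finally show ?thesis .
  qed
  show "summable (\<lambda>n. \<Sum>i. r i n)"
    by (rule summableI_nonneg_bounded[OF _ bound]) (auto intro: suminf_nonneg s nonneg)
  then show "(\<Sum>n. \<Sum>i. r i n) \<le> suminf t"
    by (rule suminf_le_const) (rule bound)
qed

lemma norm_suminf_swap:
  fixes d :: "nat \<Rightarrow> nat \<Rightarrow> 'k::real_or_complex"
  assumes d: "\<And>i. summable (\<lambda>n. norm (d i n))" "\<And>i. (\<Sum>n. norm (d i n)) \<le> t i" and t: "summable t"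
  shows "summable (\<lambda>i. d i n)" "norm (\<Sum>i. d i n) \<le> (\<Sum>i. norm (d i n))"
    "summable (\<lambda>n. norm (\<Sum>i. d i n))" "(\<Sum>n. norm (\<Sum>i. d i n)) \<le> suminf t"
proof -
  note swap = nonneg_suminf_swap[of "\<lambda>i n. norm (d i n)", OF _ d t, simplified]
  show s: "summable (\<lambda>i. d i n)" for n by (rule summable_norm_real_or_complex) (rule swap)
  show le: "norm (\<Sum>i. d i n) \<le> (\<Sum>i. norm (d i n))" for n
    by (rule norm_sums_le[OF summable_sums[OF s] summable_sums[OF swap(1)]]) simp
  show sn: "summable (\<lambda>n. norm (\<Sum>i. d i n))"
    by (rule summable_comparison_test'[OF swap(2), of 0]) (use le in auto)
  show "(\<Sum>n. norm (\<Sum>i. d i n)) \<le> suminf t"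
    using suminf_le[OF le sn swap(2)] swap(3) by linarith
qed

text \<open>The coefficients left after the first \<open>I\<close> rows form the sequence
  \<open>b I\<close>, whose sum of norms is at most the \<open>I\<close>-th tail of
  \<open>t\<close>. Tested against the bounded sequence \<open>z\<close>, the remainder tends to
  0.\<close>

lemma suminf_swap_real_or_complex:
  fixes d :: "nat \<Rightarrow> nat \<Rightarrow> 'k::real_or_complex"
  assumes d: "\<And>i. summable (\<lambda>n. norm (d i n))" "\<And>i. (\<Sum>n. norm (d i n)) \<le> t i" and t: "summable t"
    and z: "\<And>n. norm (z n) \<le> Z" "\<And>i. (\<lambda>n. d i n * z n) sums \<phi> i" "\<phi> sums x"
  shows "(\<lambda>n. (\<Sum>i. d i n) * z n) sums x"
proof -
  define b where "b I n = (\<Sum>i. d (i + I) n)" for I n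
  have t': "summable (\<lambda>i. t (i + I))" for I using t by (simp add: summable_iff_shift)
  note swap = norm_suminf_swap[of "\<lambda>i. d (i + I)" "\<lambda>i. t (i + I)" for I, OF d t']
  have b: "summable (\<lambda>n. norm (b I n))" "(\<Sum>n. norm (b I n)) \<le> (\<Sum>i. t (i + I))" for I
    unfolding b_def using swap(3,4) by auto
  have Z: "0 \<le> Z" using z(1)[of 0] norm_ge_zero order_trans by blast
  have bz: "norm (b I n * z n) \<le> norm (b I n) * Z" for I n
    unfolding norm_mult using z(1) by (intro mult_left_mono) auto
  have "summable (\<lambda>n. norm (b 0 n * z n))"
    by (rule summable_comparison_test'[OF summable_mult2[OF b(1)[of 0], of Z], of 0]) (use bz in auto)
  then have "summable (\<lambda>n. b 0 n * z n)" by (rule summable_norm_real_or_complex)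
  then obtain S where S: "(\<lambda>n. b 0 n * z n) sums S" by blast
  have "norm (S - sum \<phi> {..<I}) \<le> (\<Sum>i. t (i + I)) * Z" for I
  proof -
    have "(\<lambda>n. b 0 n * z n - (\<Sum>i<I. d i n * z n)) sums (S - sum \<phi> {..<I})"
      by (intro sums_diff S sums_sum z)
    moreover have "b 0 n = b I n + (\<Sum>i<I. d i n)" for n
      using suminf_split_initial_segment[OF swap(1)[of 0 n, simplified], of I] by (simp add: b_def)
    ultimately have *: "(\<lambda>n. b I n * z n) sums (S - sum \<phi> {..<I})"
      by (simp add: distrib_right sum_distrib_right)
    have "norm (S - sum \<phi> {..<I}) \<le> (\<Sum>n. norm (b I n)) * Z"
      by (rule norm_sums_le[OF * sums_mult2[OF summable_sums[OF b(1)]] bz])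
    also have "\<dots> \<le> (\<Sum>i. t (i + I)) * Z" using b(2) Z by (intro mult_right_mono) auto
    finally show ?thesis .
  qed
  moreover have "(\<lambda>I. (\<Sum>i. t (i + I)) * Z) \<longlonglongrightarrow> 0"
    using suminf_exist_split2[OF t] tendsto_mult_left_zero by fast
  ultimately have "(\<lambda>I. S - sum \<phi> {..<I}) \<longlonglongrightarrow> 0"
    by (intro Lim_null_comparison[of "\<lambda>I. S - sum \<phi> {..<I}"]) auto
  moreover have "(\<lambda>I. S - sum \<phi> {..<I}) \<longlonglongrightarrow> S - x"
    using z(3) by (intro tendsto_diff tendsto_const) (simp add: sums_def)
  ultimately have "S = x" using LIMSEQ_unique by fastforce
  then show ?thesis using S by (simp add: b_def)
qed

text \<open>With \<open>r n\<close> the tail starting at \<open>n\<close>,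
  \<open>l n = r n - r (Suc n)\<close>. Factoring this as a difference of squares gives
  \<open>l n / sqrt (r n) \<le> 2 * (sqrt (r n) - sqrt (r (Suc n)))\<close>, which
  telescopes.\<close>

lemma summable_divide_sqrt_tail:
  fixes l :: "nat \<Rightarrow> real"
  assumes l: "summable l" "\<And>n. 0 < l n"
  obtains \<epsilon> where "decseq \<epsilon>" "\<epsilon> \<longlonglongrightarrow> 0" "\<And>n. 0 < \<epsilon> n" "summable (\<lambda>n. l n / \<epsilon> n)"
proof
  define r where "r n = (\<Sum>i. l (i + n))" for n
  have Suc: "r n = l n + r (Suc n)" for n
    using suminf_split_head[of "\<lambda>i. l (i + n)"] l(1) by (simp add: r_def summable_iff_shift)
  have pos: "0 < r n" for n
    unfolding r_def using l by (intro suminf_pos) (simp_all add: summable_iff_shift)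
  have lim: "(\<lambda>n. sqrt (r n)) \<longlonglongrightarrow> 0"
    using tendsto_real_sqrt[OF suminf_exist_split2[OF l(1)]] by (simp add: r_def)
  have "r (Suc n) \<le> r n" for n using Suc[of n] l(2)[of n] by simp
  then show "decseq (\<lambda>n. sqrt (r n))" by (intro decseq_SucI) simp
  show "(\<lambda>n. sqrt (r n)) \<longlonglongrightarrow> 0" by (rule lim)
  show "0 < sqrt (r n)" for n using pos by simp
  have "summable (\<lambda>n. 2 * (sqrt (r n) - sqrt (r (Suc n))))"
    by (intro summable_mult telescope_summable'[OF lim])
  then show "summable (\<lambda>n. l n / sqrt (r n))"
  proof (rule summable_comparison_test'[of _ 0])
    fix n
    have le: "sqrt (r (Suc n)) \<le> sqrt (r n)" using Suc[of n] l(2)[of n] by simp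
    have "l n = sqrt (r n) ^ 2 - sqrt (r (Suc n)) ^ 2" using Suc[of n] pos[of n] pos[of "Suc n"] by simp
    also have "\<dots> = (sqrt (r n) - sqrt (r (Suc n))) * (sqrt (r n) + sqrt (r (Suc n)))"
      by (simp add: power2_eq_square algebra_simps)
    also have "\<dots> \<le> (sqrt (r n) - sqrt (r (Suc n))) * (2 * sqrt (r n))"
      using le by (intro mult_left_mono) auto
    finally show "norm (l n / sqrt (r n)) \<le> 2 * (sqrt (r n) - sqrt (r (Suc n)))"
      using pos[of n] l(2)[of n] by (simp add: divide_le_eq mult_ac)
  qed
qed

section \<open>Locally convex topologies\<close>

text \<open>Serves F(\<Omega>) as well as the normed space \<open>W\<close>, the latter through the
  sublocale \<open>normed\<close> below; both are subspaces of one ambient type.\<close>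

locale locally_convex = vector_space s for s :: "'k::real_normed_field \<Rightarrow> 'v::ab_group_add \<Rightarrow> 'v" +
  fixes X :: "'v topology"
  assumes subspace: "subspace (topspace X)"
    and seminorms: "\<exists>P. (\<forall>p\<in>P. seminorm_on s (topspace X) p) \<and> X = seminorm_topology (topspace X) P"
begin

abbreviation V where "V \<equiv> topspace X"

lemmas V_closed [simp, intro] = subspace_0[OF subspace] subspace_add[OF subspace]
  subspace_diff[OF subspace] subspace_scale[OF subspace] subspace_neg[OF subspace]

lemma seminorm_zero [simp]:
  assumes "seminorm_on s V p"
  shows "p 0 = 0"
  using assms V_closed(1) unfolding seminorm_on_def by (metis norm_zero mult_zero_left scale_zero_left)

lemma seminorm_minus:
  assumes "seminorm_on s V p" "f \<in> V"
  shows "p (- f) = p f"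
proof -
  have "p (s (- 1) f) = norm (- 1 :: 'k) * p f" using assms unfolding seminorm_on_def by blast
  then show ?thesis by simp
qed

lemma seminorm_nonneg:
  assumes "seminorm_on s V p" "f \<in> V"
  shows "0 \<le> p f"
proof -
  have "p (f + - f) \<le> p f + p (- f)" using assms unfolding seminorm_on_def by blast
  then show ?thesis using assms by (simp add: seminorm_minus)
qed

lemma seminorm_diff_le:
  assumes "seminorm_on s V p" "f \<in> V" "g \<in> V"
  shows "p (f - g) \<le> p f + p g" "\<bar>p f - p g\<bar> \<le> p (f - g)"
proof -
  have add: "p (x + y) \<le> p x + p y" if "x \<in> V" "y \<in> V" for x y
    using assms(1) that unfolding seminorm_on_def by blast
  show "p (f - g) \<le> p f + p g"
    using add[of f "- g"] assms by (simp add: seminorm_minus)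
  show "\<bar>p f - p g\<bar> \<le> p (f - g)"
    using add[of "f - g" g] add[of "g - f" f] assms seminorm_minus[OF assms(1), of "f - g"] by simp
qed

lemma continuous_seminormD:
  assumes "continuous_seminorm s X q"
  shows "seminorm_on s V q" "continuous_map X euclideanreal q"
  using assms by (auto simp: continuous_seminorm_def)

text \<open>The subbasic balls have arbitrary centres, so the preimage of such a ball under a
  translation is again one.\<close>

lemma continuous_map_translation:
  assumes "a \<in> V"
  shows "continuous_map X X (\<lambda>f. f - a)"
proof -
  obtain P where X: "X = seminorm_topology V P" using seminorms by blast
  let ?S = "insert V {{y \<in> V. p (y - x) < r} | p x r. p \<in> P \<and> x \<in> V \<and> 0 < r}"
  have X': "X = topology_generated_by ?S" using X by (simp add: seminorm_topology_def)
  have "continuous_map X (topology_generated_by ?S) (\<lambda>f. f - a)"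
  proof (intro continuous_on_generated_topo_iff[THEN iffD2] conjI allI impI)
    fix U assume "U \<in> ?S"
    then consider "U = V" | p x r where "U = {y \<in> V. p (y - x) < r}" "p \<in> P" "x \<in> V" "0 < r" by blast
    then show "openin X ((\<lambda>f. f - a) -` U \<inter> V)"
    proof cases
      case 1
      then have "(\<lambda>f. f - a) -` U \<inter> V = V" using assms by auto
      then show ?thesis by simp
    next
      case 2
      then have "(\<lambda>f. f - a) -` U \<inter> V = {y \<in> V. p (y - (x + a)) < r}"
        using assms by (auto simp: algebra_simps)
      moreover have "\<dots> \<in> ?S" using 2 assms by blast
      ultimately have "openin (topology_generated_by ?S) ((\<lambda>f. f - a) -` U \<inter> V)"
        by (simp only: topology_generated_by_Basis)
      then show ?thesis unfolding X'[symmetric] .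
    qed
  qed (use assms in auto)
  then show ?thesis unfolding X'[symmetric] .
qed

lemma openin_seminorm_ball:
  assumes q: "continuous_seminorm s X q" and "a \<in> V"
  shows "openin X {f \<in> V. q (f - a) < r}"
proof -
  have "continuous_map X euclideanreal (q \<circ> (\<lambda>f. f - a))"
    using continuous_map_translation[OF \<open>a \<in> V\<close>] continuous_seminormD(2)[OF q] by (rule continuous_map_compose)
  then have "openin X {f \<in> V. (q \<circ> (\<lambda>f. f - a)) f \<in> {..<r}}"
    by (rule openin_continuous_map_preimage) auto
  then show ?thesis by simp
qed

lemma continuous_map_dominated:
  fixes g :: "'v \<Rightarrow> 'z::metric_space"
  assumes q: "continuous_seminorm s X q"
    and g: "\<And>x y. x \<in> V \<Longrightarrow> y \<in> V \<Longrightarrow> dist (g y) (g x) \<le> C * q (y - x)"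
  shows "continuous_map X euclidean g"
  unfolding continuous_map_def
proof (intro conjI allI impI)
  fix G :: "'z set" assume "openin euclidean G"
  then have G: "open G" by simp
  show "openin X {x \<in> V. g x \<in> G}"
  proof (subst openin_subopen, intro ballI)
    fix x assume "x \<in> {x \<in> V. g x \<in> G}"
    then have x: "x \<in> V" "g x \<in> G" by auto
    then obtain e where e: "0 < e" "\<And>z. dist z (g x) < e \<Longrightarrow> z \<in> G" using G open_dist by metis
    \<comment> \<open>Using \<open>\<bar>C\<bar> + 1\<close> in place of \<open>C\<close> makes the
      radius positive for every \<open>C\<close>.\<close>
    let ?B = "{y \<in> V. q (y - x) < e / (\<bar>C\<bar> + 1)}"
    have "g y \<in> G" if "y \<in> ?B" for y
    proof (rule e(2))
      have "dist (g y) (g x) \<le> C * q (y - x)" using g x that by auto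
      also have "\<dots> \<le> (\<bar>C\<bar> + 1) * q (y - x)"
        using that x seminorm_nonneg[OF continuous_seminormD(1)[OF q]] by (intro mult_right_mono) auto
      also have "\<dots> < e" using that by (simp add: field_simps)
      finally show "dist (g y) (g x) < e" .
    qed
    moreover have "x \<in> ?B" using x e continuous_seminormD(1)[OF q] by simp
    ultimately show "\<exists>T. openin X T \<and> x \<in> T \<and> T \<subseteq> {x \<in> V. g x \<in> G}"
      using openin_seminorm_ball[OF q x(1)] by blast
  qed
qed auto

lemma continuous_seminorm_generating:
  assumes "\<And>p. p \<in> P \<Longrightarrow> seminorm_on s V p" "X = seminorm_topology V P" "p \<in> P"
  shows "continuous_seminorm s X p"
  unfolding continuous_seminorm_def continuous_map_def
proof (intro conjI allI impI)
  note p = assms(1)[OF assms(3)]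
  fix G :: "real set" assume "openin euclideanreal G"
  then have G: "open G" by simp
  show "openin X {x \<in> V. p x \<in> G}"
  proof (subst openin_subopen, intro ballI)
    fix x assume "x \<in> {x \<in> V. p x \<in> G}"
    then have x: "x \<in> V" "p x \<in> G" by auto
    then obtain e where e: "0 < e" "\<And>z. dist z (p x) < e \<Longrightarrow> z \<in> G" using G open_dist by metis
    have "openin X {y \<in> V. p (y - x) < e}"
      by (subst assms(2), unfold seminorm_topology_def, rule topology_generated_by_Basis)
         (use assms(3) x e in blast)
    moreover have "x \<in> {y \<in> V. p (y - x) < e}" using x e p by simp
    moreover have "{y \<in> V. p (y - x) < e} \<subseteq> {x \<in> V. p x \<in> G}"
      using e(2) seminorm_diff_le(2)[OF p _ x(1)] by (force simp: dist_real_def)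
    ultimately show "\<exists>T. openin X T \<and> x \<in> T \<and> T \<subseteq> {x \<in> V. p x \<in> G}" by blast
  qed
qed (use assms in auto)

section \<open>Continuous seminorms as neighbourhoods of 0, and bounded sets\<close>

lemma continuous_seminorm_add:
  assumes "continuous_seminorm s X p" "continuous_seminorm s X q"
  shows "continuous_seminorm s X (\<lambda>f. p f + q f)"
  using assms unfolding continuous_seminorm_def seminorm_on_def
  by (auto intro: continuous_map_add simp: distrib_left) (smt (verit))

lemma continuous_seminorm_cmult:
  assumes "continuous_seminorm s X p" "0 \<le> c"
  shows "continuous_seminorm s X (\<lambda>f. c * p f)"
  using assms unfolding continuous_seminorm_def seminorm_on_def
  by (auto intro: continuous_map_real_mult_left simp flip: distrib_left simp: mult_left_mono)

lemma continuous_seminorm_zero: "continuous_seminorm s X (\<lambda>f. 0)"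
  unfolding continuous_seminorm_def seminorm_on_def by auto

text \<open>Induction on the generation of open sets: intersections lead to sums of seminorms, and a
  ball of radius \<open>r\<close> about \<open>x\<close> that contains 0 also contains the ball of
  radius \<open>r - p x\<close> about 0.\<close>

lemma openin_contains_seminorm_ball:
  assumes "openin X U" "0 \<in> U"
  obtains q where "continuous_seminorm s X q" "\<And>f. f \<in> V \<Longrightarrow> q f < 1 \<Longrightarrow> f \<in> U"
proof -
  obtain P where P: "\<And>p. p \<in> P \<Longrightarrow> seminorm_on s V p" "X = seminorm_topology V P"
    using seminorms by blast
  have "generate_topology_on
      (insert V {{y \<in> V. p (y - x) < r} | p x r. p \<in> P \<and> x \<in> V \<and> 0 < r}) U"
    using subst[where P="\<lambda>Y. openin Y U", OF P(2) assms(1)]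
    unfolding seminorm_topology_def openin_topology_generated_by_iff .
  then have "0 \<in> U \<longrightarrow> (\<exists>q. continuous_seminorm s X q \<and> (\<forall>f\<in>V. q f < 1 \<longrightarrow> f \<in> U))"
  proof induction
    case Empty
    then show ?case by simp
  next
    case (Int a b)
    show ?case
    proof
      assume "0 \<in> a \<inter> b"
      with Int obtain p q where p: "continuous_seminorm s X p" "\<forall>f\<in>V. p f < 1 \<longrightarrow> f \<in> a"
        and q: "continuous_seminorm s X q" "\<forall>f\<in>V. q f < 1 \<longrightarrow> f \<in> b" by blast
      have "f \<in> a \<inter> b" if "f \<in> V" "p f + q f < 1" for f
        using seminorm_nonneg[OF continuous_seminormD(1)[OF p(1)] that(1)]
          seminorm_nonneg[OF continuous_seminormD(1)[OF q(1)] that(1)] p(2) q(2) that by auto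
      then show "\<exists>q. continuous_seminorm s X q \<and> (\<forall>f\<in>V. q f < 1 \<longrightarrow> f \<in> a \<inter> b)"
        using continuous_seminorm_add[OF p(1) q(1)] by blast
    qed
  next
    case (UN K)
    then show ?case by blast
  next
    case (Basis A)
    then consider "A = V" | p x r where "A = {y \<in> V. p (y - x) < r}" "p \<in> P" "x \<in> V" "0 < r" by blast
    then show ?case
    proof cases
      case 1
      then show ?thesis using continuous_seminorm_zero by blast
    next
      case 2
      show ?thesis
      proof
        assume "0 \<in> A"
        then have r: "p x < r" using 2 seminorm_minus[OF P(1)[OF 2(2)] 2(3)] by simp
        have "f \<in> A" if "f \<in> V" "1 / (r - p x) * p f < 1" for f
          using that r 2 seminorm_diff_le(1)[OF P(1)[OF 2(2)] that(1) 2(3)] by (simp add: field_simps)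
        moreover have "continuous_seminorm s X (\<lambda>f. 1 / (r - p x) * p f)"
          using continuous_seminorm_generating[OF P 2(2)] r by (intro continuous_seminorm_cmult) auto
        ultimately show "\<exists>q. continuous_seminorm s X q \<and> (\<forall>f\<in>V. q f < 1 \<longrightarrow> f \<in> A)" by blast
      qed
    qed
  qed
  then show ?thesis using assms(2) that by blast
qed

lemma linear_zero:
  assumes "linear_on s (*) V u"
  shows "u 0 = 0"
  using assms V_closed(1) unfolding linear_on_def by (metis mult_zero_left scale_zero_left)

lemma linear_diff:
  assumes "linear_on s (*) V u" "f \<in> V" "g \<in> V"
  shows "u (f - g) = u f - u g"
proof -
  have "u (f - g + g) = u (f - g) + u g" using assms unfolding linear_on_def by blast
  then show ?thesis by simp
qed

lemma seminorm_norm_linear: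
  assumes "linear_on s (*) V u"
  shows "seminorm_on s V (\<lambda>f. norm (u f))"
  using assms unfolding linear_on_def seminorm_on_def by (auto simp: norm_mult norm_triangle_ineq)

lemma continuous_linear_dominated:
  assumes u: "linear_on s (*) V u" and q: "continuous_seminorm s X q"
    and bound: "\<And>f. f \<in> V \<Longrightarrow> norm (u f) \<le> C * q f"
  shows "continuous_map X euclidean u"
  using q by (rule continuous_map_dominated[of _ _ C]) (auto simp: dist_norm bound simp flip: linear_diff[OF u])

lemma continuous_seminorm_norm_linear:
  assumes "linear_on s (*) V u" "continuous_map X euclidean u"
  shows "continuous_seminorm s X (\<lambda>f. norm (u f))"
  using assms seminorm_norm_linear by (auto simp: continuous_seminorm_def intro: continuous_map_norm)

text \<open>If \<open>q f = 0\<close>, then \<open>f\<close> cannot be normalised; so it is scaled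
  by an arbitrary \<open>t > q f\<close>, and \<open>t\<close> decreases to
  \<open>q f\<close>.\<close>

lemma seminorm_le_scale:
  assumes p: "seminorm_on s V p" and q: "seminorm_on s V q" and "0 \<le> C"
    and le: "\<And>f. f \<in> V \<Longrightarrow> q f \<le> 1 \<Longrightarrow> p f \<le> C" and f: "f \<in> V"
  shows "p f \<le> C * q f"
proof -
  have "p f \<le> C * t" if t: "q f < t" for t
  proof -
    have "0 < t" using t seminorm_nonneg[OF q f] by simp
    define c where "c = inverse (of_real t :: 'k)"
    have c: "norm c = 1 / t" using \<open>0 < t\<close> by (simp add: c_def norm_inverse divide_inverse)
    have "q (s c f) = q f / t" "p (s c f) = p f / t"
      using p q f c unfolding seminorm_on_def by auto
    moreover have "q f / t \<le> 1" using t \<open>0 < t\<close> by simp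
    ultimately have "p f / t \<le> C" using le[of "s c f"] f by simp
    then show ?thesis using \<open>0 < t\<close> by (simp add: field_simps)
  qed
  note * = this
  show ?thesis
  proof (cases "C = 0")
    case True
    then show ?thesis using *[of "q f + 1"] by simp
  next
    case False
    have "p f / C \<le> q f"
    proof (rule dense_ge)
      fix t assume "q f < t"
      then show "p f / C \<le> t" using *[of t] False \<open>0 \<le> C\<close> by (simp add: field_simps)
    qed
    then show ?thesis using False \<open>0 \<le> C\<close> by (simp add: field_simps)
  qed
qed

lemma tvs_bounded_seminorm:
  assumes A: "tvs_bounded s X A" and q: "continuous_seminorm s X q"
  obtains M where "0 \<le> M" "\<And>f. f \<in> A \<Longrightarrow> q f \<le> M"
proof -
  let ?U = "{f \<in> V. q (f - 0) < 1}"
  have "openin X ?U" "0 \<in> ?U"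
    using openin_seminorm_ball[OF q, of 0] continuous_seminormD(1)[OF q] by auto
  then obtain r where r: "0 < r" "\<And>c. r \<le> norm c \<Longrightarrow> A \<subseteq> s c ` ?U"
    using A unfolding tvs_bounded_def by meson
  have "q f \<le> r" if "f \<in> A" for f
  proof -
    have "f \<in> s (of_real r) ` ?U" using r(2)[of "of_real r"] r(1) that by auto
    then obtain g where g: "g \<in> V" "q g < 1" "f = s (of_real r) g" by auto
    then have "q f = r * q g"
      using continuous_seminormD(1)[OF q] r(1) unfolding seminorm_on_def by simp
    then show ?thesis using g(2) r(1) by (simp add: mult_left_le)
  qed
  then show ?thesis using that[of r] r(1) by auto
qed

text \<open>Converse of \<open>tvs_bounded_seminorm\<close>: a neighbourhood of 0 contains a
  seminorm ball, and multiples of that ball absorb \<open>A\<close> once \<open>q\<close> is bounded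
  on \<open>A\<close>.\<close>

lemma tvs_boundedI:
  assumes "A \<subseteq> V" and bounded: "\<And>q. continuous_seminorm s X q \<Longrightarrow> \<exists>M. \<forall>f\<in>A. q f \<le> M"
  shows "tvs_bounded s X A"
  unfolding tvs_bounded_def
proof (intro conjI allI impI assms(1))
  fix U assume "openin X U \<and> 0 \<in> U"
  then obtain q where q: "continuous_seminorm s X q" "\<And>f. f \<in> V \<Longrightarrow> q f < 1 \<Longrightarrow> f \<in> U"
    using openin_contains_seminorm_ball by metis
  obtain M where M: "\<And>f. f \<in> A \<Longrightarrow> q f \<le> M" using bounded[OF q(1)] by blast
  have "A \<subseteq> s c ` U" if c: "\<bar>M\<bar> + 1 \<le> norm c" for c
  proof
    fix f assume f: "f \<in> A"
    then have fV: "f \<in> V" using assms(1) by auto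
    have "c \<noteq> 0" using c by auto
    have "q (s (inverse c) f) = q f / norm c"
      using continuous_seminormD(1)[OF q(1)] fV unfolding seminorm_on_def
      by (simp add: norm_inverse divide_inverse mult.commute)
    also have "\<dots> < 1" using M[OF f] c by (subst divide_less_eq) auto
    finally have "s (inverse c) f \<in> U" using q(2) fV by blast
    moreover have "f = s c (s (inverse c) f)" using \<open>c \<noteq> 0\<close> by simp
    ultimately show "f \<in> s c ` U" by blast
  qed
  then show "\<exists>r>0. \<forall>c. r \<le> norm c \<longrightarrow> A \<subseteq> s c ` U" by (intro exI[of _ "\<bar>M\<bar> + 1"]) auto
qed

text \<open>Ensures that the suprema defining the strong dual are taken over bounded sets of
  reals.\<close>

lemma bdd_above_dual:
  assumes "tvs_bounded s X A" "u \<in> dual s X"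
  shows "bdd_above ((\<lambda>f. norm (u f)) ` A)"
proof -
  have "continuous_seminorm s X (\<lambda>f. norm (u f))"
    using assms(2) by (intro continuous_seminorm_norm_linear) (auto simp: dual_def)
  from tvs_bounded_seminorm[OF assms(1) this] show ?thesis by (metis bdd_aboveI2)
qed

text \<open>Metrizability yields a countable base at 0; each base set contains a seminorm ball, and
  partial sums make the seminorms increasing.\<close>

lemma fundamental_seminorms:
  assumes "metrizable_space X"
  obtains q :: "nat \<Rightarrow> 'v \<Rightarrow> real" where "\<And>k. continuous_seminorm s X (q k)"
    "\<And>k l f. f \<in> V \<Longrightarrow> k \<le> l \<Longrightarrow> q k f \<le> q l f"
    "\<And>p. continuous_seminorm s X p \<Longrightarrow> \<exists>k. \<forall>f\<in>V. p f \<le> q k f"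
proof -
  obtain \<B> where \<B>: "countable \<B>"
    "\<And>U. openin X U \<Longrightarrow> 0 \<in> U \<Longrightarrow> \<exists>W\<in>\<B>. openin X W \<and> 0 \<in> W \<and> W \<subseteq> U"
    using metrizable_imp_first_countable[OF assms] V_closed(1) unfolding first_countable_def by metis
  define W where "W = from_nat_into \<B>"
  \<comment> \<open>Members of \<open>\<B>\<close> that are not open neighbourhoods of 0 get the
    zero seminorm.\<close>
  have "\<exists>q. continuous_seminorm s X q \<and> (openin X (W k) \<and> 0 \<in> W k \<longrightarrow> (\<forall>f\<in>V. q f \<le> 1 \<longrightarrow> f \<in> W k))" for k
  proof (cases "openin X (W k) \<and> 0 \<in> W k")
    case True
    then obtain q where q: "continuous_seminorm s X q" "\<And>f. f \<in> V \<Longrightarrow> q f < 1 \<Longrightarrow> f \<in> W k"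
      using openin_contains_seminorm_ball by blast
    \<comment> \<open>Doubling puts a closed unit ball inside the open one, as required by the
      condition \<open>\<le> 1\<close> in \<open>seminorm_le_scale\<close>.\<close>
    have "continuous_seminorm s X (\<lambda>f. 2 * q f)" using q(1) by (rule continuous_seminorm_cmult) simp
    moreover have "f \<in> W k" if "f \<in> V" "2 * q f \<le> 1" for f using q(2)[OF that(1)] that(2) by simp
    ultimately show ?thesis by blast
  qed (use continuous_seminorm_zero in blast)
  then obtain q0 where q0: "\<And>k. continuous_seminorm s X (q0 k)"
    "\<And>k f. openin X (W k) \<Longrightarrow> 0 \<in> W k \<Longrightarrow> f \<in> V \<Longrightarrow> q0 k f \<le> 1 \<Longrightarrow> f \<in> W k" by metis
  define q where "q k f = (\<Sum>j\<le>k. q0 j f)" for k f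
  have q: "continuous_seminorm s X (q k)" for k
  proof (induction k)
    case 0
    then show ?case unfolding q_def using q0(1)[of 0] by simp
  next
    case (Suc k)
    then show ?case
      using continuous_seminorm_add[OF _ q0(1), of "q k" "Suc k"] by (simp add: q_def[abs_def])
  qed
  have nonneg: "0 \<le> q0 k f" if "f \<in> V" for k f
    using seminorm_nonneg[OF continuous_seminormD(1)[OF q0(1)] that] .
  show ?thesis
  proof (rule that[of q])
    show "q k f \<le> q l f" if "f \<in> V" "k \<le> l" for k l f
      unfolding q_def using that nonneg by (intro sum_mono2) auto
    fix p assume p: "continuous_seminorm s X p"
    have "openin X {f \<in> V. p (f - 0) < 1}" "0 \<in> {f \<in> V. p (f - 0) < 1}"
      using openin_seminorm_ball[OF p, of 0] continuous_seminormD(1)[OF p] by auto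
    from \<B>(2)[OF this] obtain W0 where
      W0: "W0 \<in> \<B>" "openin X W0" "0 \<in> W0" "W0 \<subseteq> {f \<in> V. p (f - 0) < 1}" by blast
    then obtain k where "W k = W0" using from_nat_into_surj[OF \<B>(1)] unfolding W_def by blast
    with W0 have k: "openin X (W k)" "0 \<in> W k" "W k \<subseteq> {f \<in> V. p (f - 0) < 1}" by auto
    have "p f \<le> 1 * q k f" if "f \<in> V" for f
    proof (rule seminorm_le_scale[OF continuous_seminormD(1)[OF p] continuous_seminormD(1)[OF q] _ _ that])
      fix g assume g: "g \<in> V" "q k g \<le> 1"
      have "q0 k g \<le> q k g" unfolding q_def using nonneg[OF g(1)] by (intro member_le_sum) auto
      then show "p g \<le> 1" using q0(2)[OF k(1,2) g(1)] g k(3) by force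
    qed simp
    then show "\<exists>k. \<forall>f\<in>V. p f \<le> q k f" by auto
  qed (rule q)
qed

end

section \<open>Strong duals: convergence, and equicontinuity of bounded sets\<close>

lemma limitin_seminorm_topology:
  fixes \<sigma> :: "nat \<Rightarrow> 'v::ab_group_add"
  assumes \<sigma>: "\<And>n. \<sigma> n \<in> H" "l \<in> H"
    and triangle: "\<And>p x n. p \<in> P \<Longrightarrow> x \<in> H \<Longrightarrow> p (\<sigma> n - x) \<le> p (\<sigma> n - l) + p (l - x)"
    and lim: "\<And>p. p \<in> P \<Longrightarrow> (\<lambda>n. p (\<sigma> n - l)) \<longlonglongrightarrow> 0"
  shows "limitin (seminorm_topology H P) \<sigma> l sequentially"
  unfolding limitin_def
proof (intro conjI allI impI)
  show "l \<in> topspace (seminorm_topology H P)" using \<sigma> by simp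
  fix U assume U: "openin (seminorm_topology H P) U \<and> l \<in> U"
  then have "generate_topology_on
      (insert H {{y \<in> H. p (y - x) < r} | p x r. p \<in> P \<and> x \<in> H \<and> 0 < r}) U"
    unfolding seminorm_topology_def openin_topology_generated_by_iff by blast
  then have "l \<in> U \<longrightarrow> (\<forall>\<^sub>F n in sequentially. \<sigma> n \<in> U)"
  proof induction
    case Empty
    then show ?case by simp
  next
    case (Int a b)
    then show ?case by (auto simp: eventually_conj_iff)
  next
    case (UN K)
    show ?case
    proof
      assume "l \<in> \<Union> K"
      then obtain a where "a \<in> K" "\<forall>\<^sub>F n in sequentially. \<sigma> n \<in> a" using UN by blast
      then show "\<forall>\<^sub>F n in sequentially. \<sigma> n \<in> \<Union> K" by (auto elim: eventually_mono)
    qed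
  next
    case (Basis A)
    then consider "A = H" | p x r where "A = {y \<in> H. p (y - x) < r}" "p \<in> P" "x \<in> H" "0 < r" by blast
    then show ?case
    proof cases
      case 1
      then show ?thesis using \<sigma> by simp
    next
      case 2
      show ?thesis
      proof
        assume "l \<in> A"
        \<comment> \<open>The ball is centred at \<open>x\<close> rather than at \<open>l\<close>,
          so the limit only has to bring \<open>p (\<sigma> n - l)\<close> below the remaining
          \<open>r - p (l - x)\<close>.\<close>
        then have "0 < r - p (l - x)" using 2 by simp
        with lim[OF 2(2)] have "\<forall>\<^sub>F n in sequentially. p (\<sigma> n - l) < r - p (l - x)"
          by (rule order_tendstoD)
        then show "\<forall>\<^sub>F n in sequentially. \<sigma> n \<in> A"
        proof eventually_elim
          case (elim n)
          then show ?case using triangle[OF 2(2,3), of n] \<sigma>(1) 2(1) by simp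
        qed
      qed
    qed
  qed
  then show "\<forall>\<^sub>F n in sequentially. \<sigma> n \<in> U" using U by blast
qed

context locally_convex
begin

lemma SUP_norm_dual_triangle:
  assumes A: "tvs_bounded s X A" "A \<noteq> {}" and u: "u \<in> dual s X" "v \<in> dual s X" "w \<in> dual s X"
  shows "(SUP f\<in>A. norm ((u - w) f)) \<le> (SUP f\<in>A. norm ((u - v) f)) + (SUP f\<in>A. norm ((v - w) f))"
proof -
  have bdd: "bdd_above ((\<lambda>f. norm ((u - v) f)) ` A)" if uv: "u \<in> dual s X" "v \<in> dual s X" for u v
  proof -
    obtain M1 M2 where "\<And>f. f \<in> A \<Longrightarrow> norm (u f) \<le> M1" "\<And>f. f \<in> A \<Longrightarrow> norm (v f) \<le> M2"
      using bdd_above_dual[OF A(1)] uv unfolding bdd_above_def by (metis imageI)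
    then have "norm ((u - v) f) \<le> M1 + M2" if "f \<in> A" for f
      using that norm_triangle_ineq4[of "u f" "v f"] by fastforce
    then show ?thesis by (rule bdd_aboveI2)
  qed
  show ?thesis
  proof (rule cSUP_least[OF A(2)])
    fix f assume f: "f \<in> A"
    have "norm ((u - w) f) \<le> norm ((u - v) f) + norm ((v - w) f)"
      using norm_triangle_ineq[of "(u - v) f" "(v - w) f"] by simp
    also have "\<dots> \<le> (SUP f\<in>A. norm ((u - v) f)) + (SUP f\<in>A. norm ((v - w) f))"
      using f by (intro add_mono cSUP_upper bdd u)
    finally show "norm ((u - w) f) \<le> \<dots>" .
  qed
qed

text \<open>A bounded set is bounded for the single seminorm \<open>p\<close>, so the pointwise
  estimate is uniform on it.\<close>

lemma limitin_strong_dual: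
  fixes \<sigma> :: "nat \<Rightarrow> 'v \<Rightarrow> 'k"
  assumes \<sigma>: "\<And>n. \<sigma> n \<in> dual s X" "u \<in> dual s X"
    and p: "continuous_seminorm s X p" and c: "c \<longlonglongrightarrow> 0"
    and le: "\<And>n f. f \<in> V \<Longrightarrow> norm (\<sigma> n f - u f) \<le> c n * p f"
  shows "limitin (strong_dual s X) \<sigma> u sequentially"
  unfolding strong_dual_def uniform_topology_def
proof (rule limitin_seminorm_topology[OF \<sigma>])
  fix P :: "('v \<Rightarrow> 'k) \<Rightarrow> real"
  assume "P \<in> {\<lambda>h. SUP x\<in>A. norm (h x) | A. A \<in> {B. tvs_bounded s X B} \<and> A \<noteq> {}}"
  then obtain A where P: "P = (\<lambda>h. SUP x\<in>A. norm (h x))" and A: "tvs_bounded s X A" "A \<noteq> {}" by blast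
  show "P (\<sigma> n - w) \<le> P (\<sigma> n - u) + P (u - w)" if "w \<in> dual s X" for w n
    unfolding P by (rule SUP_norm_dual_triangle[OF A \<sigma> that])
  obtain M where M: "0 \<le> M" "\<And>f. f \<in> A \<Longrightarrow> p f \<le> M" using tvs_bounded_seminorm[OF A(1) p] by blast
  obtain f0 where f0: "f0 \<in> A" using A(2) by blast
  have AV: "A \<subseteq> V" using A(1) by (simp add: tvs_bounded_def)
  have le': "norm (\<sigma> n f - u f) \<le> \<bar>c n\<bar> * M" if "f \<in> A" for n f
  proof -
    have "norm (\<sigma> n f - u f) \<le> c n * p f" using le that AV by blast
    also have "\<dots> \<le> \<bar>c n\<bar> * M"
      using that AV M seminorm_nonneg[OF continuous_seminormD(1)[OF p]] by (intro mult_mono) auto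
    finally show ?thesis .
  qed
  have "norm (P (\<sigma> n - u)) \<le> \<bar>c n\<bar> * M" for n
  proof -
    have "P (\<sigma> n - u) \<le> \<bar>c n\<bar> * M"
      unfolding P using le' by (intro cSUP_least[OF A(2)]) simp
    moreover have "norm ((\<sigma> n - u) f0) \<le> P (\<sigma> n - u)"
      unfolding P using le' by (intro cSUP_upper[OF f0] bdd_aboveI2) simp
    then have "0 \<le> P (\<sigma> n - u)" using norm_ge_zero order_trans by blast
    ultimately show ?thesis by simp
  qed
  then show "(\<lambda>n. P (\<sigma> n - u)) \<longlonglongrightarrow> 0"
    by (intro Lim_null_comparison[of "\<lambda>n. P (\<sigma> n - u)" "\<lambda>n. \<bar>c n\<bar> * M"] always_eventually allI
        tendsto_mult_left_zero tendsto_rabs_zero c)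
qed

text \<open>A metrizable space is bornological: if \<open>B\<close> were not equicontinuous, there would be \<open>f\<^sub>k\<close> with
  \<open>q\<^sub>k f\<^sub>k \<le> 1\<close> on which \<open>B\<close> exceeds \<open>k\<close>; these form a bounded set.\<close>

lemma strong_dual_bounded_dominated:
  assumes "metrizable_space X" and B: "tvs_bounded (fscale (*)) (strong_dual s X) B"
  obtains p where "continuous_seminorm s X p" "\<And>\<mu> f. \<mu> \<in> B \<Longrightarrow> f \<in> V \<Longrightarrow> norm (\<mu> f) \<le> p f"
proof -
  have topspace: "topspace (strong_dual s X) = dual s X"
    by (simp add: strong_dual_def uniform_topology_def)
  have BD: "B \<subseteq> dual s X" using B unfolding tvs_bounded_def topspace by blast
  obtain q :: "nat \<Rightarrow> 'v \<Rightarrow> real" where q: "\<And>k. continuous_seminorm s X (q k)"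
    and mono: "\<And>k l f. f \<in> V \<Longrightarrow> k \<le> l \<Longrightarrow> q k f \<le> q l f"
    and fund: "\<And>p. continuous_seminorm s X p \<Longrightarrow> \<exists>k. \<forall>f\<in>V. p f \<le> q k f"
    using fundamental_seminorms[OF assms(1)] by blast
  have "\<exists>k::nat. \<forall>\<mu>\<in>B. \<forall>f\<in>V. q k f \<le> 1 \<longrightarrow> norm (\<mu> f) \<le> real k"
  proof (rule ccontr)
    assume "\<not> ?thesis"
    then have "\<forall>k. \<exists>f. f \<in> V \<and> q k f \<le> 1 \<and> (\<exists>\<mu>\<in>B. real k < norm (\<mu> f))" by (meson not_le)
    then obtain g where "\<forall>k. g k \<in> V \<and> q k (g k) \<le> 1 \<and> (\<exists>\<mu>\<in>B. real k < norm (\<mu> (g k)))"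
      by (rule choice[THEN exE])
    then have g: "g k \<in> V" "q k (g k) \<le> 1" "\<exists>\<mu>\<in>B. real k < norm (\<mu> (g k))" for k by blast+
    have A: "tvs_bounded s X (range g)"
    proof (rule tvs_boundedI)
      fix p assume p: "continuous_seminorm s X p"
      then obtain k where k: "\<forall>f\<in>V. p f \<le> q k f" using fund by blast
      \<comment> \<open>From \<open>k\<close> on,
        \<open>p (g j) \<le> q k (g j) \<le> q j (g j) \<le> 1\<close>; the finitely many earlier
        values are absorbed into the sum.\<close>
      have "p (g j) \<le> 1 + (\<Sum>i<k. \<bar>p (g i)\<bar>)" for j
      proof (cases "j < k")
        case True
        have "\<bar>p (g j)\<bar> \<le> (\<Sum>i<k. \<bar>p (g i)\<bar>)" using True by (intro member_le_sum) auto
        then show ?thesis by simp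
      next
        case False
        then have "p (g j) \<le> 1" using k g[of j] mono[of "g j" k j] by force
        moreover have "0 \<le> (\<Sum>i<k. \<bar>p (g i)\<bar>)" by (simp add: sum_nonneg)
        ultimately show ?thesis by linarith
      qed
      then show "\<exists>M. \<forall>f\<in>range g. p f \<le> M" by blast
    qed (use g in auto)
    define P where "P h = (SUP f\<in>range g. norm (h f))" for h :: "'v \<Rightarrow> 'k"
    let ?U = "{h \<in> dual s X. P (h - 0) < 1}"
    have zero: "0 \<in> dual s X" by (auto simp: dual_def linear_on_def zero_fun_def)
    have "openin (strong_dual s X) ?U"
      unfolding strong_dual_def uniform_topology_def seminorm_topology_def
    proof (rule topology_generated_by_Basis, rule insertI2, rule CollectI, intro exI conjI)
      show "P \<in> {\<lambda>h. SUP x\<in>A. norm (h x) | A. A \<in> {B. tvs_bounded s X B} \<and> A \<noteq> {}}"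
        using A by (auto simp: P_def[abs_def])
    qed (use zero in auto)
    moreover have "0 \<in> ?U" using zero by (simp add: P_def)
    \<comment> \<open>Boundedness of \<open>B\<close> gives one \<open>r\<close> that bounds every
      \<open>\<mu> \<in> B\<close> on all points \<open>g k\<close>; any \<open>k > r\<close>
      contradicts the choice of \<open>g k\<close>.\<close>
    ultimately obtain r where r: "0 < r" "\<And>c. r \<le> norm c \<Longrightarrow> B \<subseteq> fscale (*) c ` ?U"
      using B unfolding tvs_bounded_def by meson
    obtain k :: nat where k: "r < real k" using reals_Archimedean2 by blast
    obtain \<mu> where \<mu>: "\<mu> \<in> B" "real k < norm (\<mu> (g k))" using g(3) by blast
    have "B \<subseteq> fscale (*) (of_real r) ` ?U" by (rule r(2)) (use r(1) in simp)
    then obtain h where h: "h \<in> dual s X" "P h < 1" "\<mu> = fscale (*) (of_real r) h" using \<mu>(1) by auto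
    have "norm (h (g k)) \<le> P h"
      unfolding P_def using bdd_above_dual[OF A h(1)] by (intro cSUP_upper) auto
    then have "norm (\<mu> (g k)) \<le> r * 1"
      using h r(1) by (simp add: fscale_def norm_mult)
    then show False using \<mu>(2) k by simp
  qed
  then obtain k :: nat where k: "\<And>\<mu> f. \<mu> \<in> B \<Longrightarrow> f \<in> V \<Longrightarrow> q k f \<le> 1 \<Longrightarrow> norm (\<mu> f) \<le> real k" by blast
  show ?thesis
  proof (rule that)
    show "continuous_seminorm s X (\<lambda>f. real k * q k f)" by (intro continuous_seminorm_cmult q) simp
    fix \<mu> f assume "\<mu> \<in> B" "f \<in> V"
    then show "norm (\<mu> f) \<le> real k * q k f"
      using BD k by (intro seminorm_le_scale[of "\<lambda>f. norm (\<mu> f)"] seminorm_norm_linear continuous_seminormD(1)[OF q])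
        (auto simp: dual_def)
  qed
qed

end

section \<open>Representation of functionals\<close>

text \<open>In the application \<open>X\<close> is the topology of F(\<Omega>), with carrier
  \<open>V\<close>, and \<open>W\<close> is \<F>\<nu>(\<Omega>) with its norm \<open>N\<close>.
  Compactness of the ball and continuity of \<open>e n\<close> refer to \<open>X\<close>, the bounds
  to \<open>N\<close>; \<open>e_le\<close> makes the supremum in \<open>N_le\<close> finite.\<close>

locale fixing_functionals = locally_convex s X
  for s :: "'k::real_or_complex \<Rightarrow> 'v::ab_group_add \<Rightarrow> 'v" and X +
  fixes W :: "'v set" and N :: "'v \<Rightarrow> real" and e :: "nat \<Rightarrow> 'v \<Rightarrow> 'k" and C :: real
  assumes W: "subspace W" "W \<subseteq> V" and N: "seminorm_on s W N"
    and compact_ball: "compactin X {f \<in> W. N f \<le> 1}"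
    and linear_e: "\<And>n. linear_on s (*) V (e n)" and continuous_e: "\<And>n. continuous_map X euclidean (e n)"
    and e_le: "\<And>f n. f \<in> W \<Longrightarrow> norm (e n f) \<le> N f"
    and C: "0 < C" and N_le: "\<And>f. f \<in> W \<Longrightarrow> N f \<le> C * (SUP n. norm (e n f))"
begin

sublocale normed: locally_convex s "norm_topology W N"
  by unfold_locales (use W N in auto)

lemma continuous_seminorm_N: "continuous_seminorm s (norm_topology W N) N"
  by (rule normed.continuous_seminorm_generating[of "{N}"]) (use N in auto)

lemma N_nonneg: "f \<in> W \<Longrightarrow> 0 \<le> N f"
  using normed.seminorm_nonneg[of N] N by simp

lemma seminorm_on_W: "seminorm_on s V p \<Longrightarrow> seminorm_on s W p"
  using W(2) unfolding seminorm_on_def by blast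

lemma linear_on_W: "linear_on s (*) V u \<Longrightarrow> linear_on s (*) W u"
  using W(2) unfolding linear_on_def by blast

lemma finitely_many_suffice:
  fixes \<phi> :: "'v \<Rightarrow> 'k"
  assumes \<phi>: "linear_on s (*) V \<phi>" "continuous_map X euclidean \<phi>"
    and "0 \<le> m" and le: "\<And>f. f \<in> W \<Longrightarrow> norm (\<phi> f) \<le> m * N f" and "0 < \<epsilon>"
  obtains M where "\<And>f. f \<in> W \<Longrightarrow> \<exists>n<M. norm (\<phi> f) \<le> m * C * norm (e n f) + \<epsilon> * N f"
proof -
  let ?K = "{f \<in> W. N f \<le> 1}"
  define G where "G n = {f \<in> V. norm (\<phi> f) - m * C * norm (e n f) \<in> {..<\<epsilon>}}" for n
  have "openin X (G n)" for n
    unfolding G_def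
    by (rule openin_continuous_map_preimage[where Y = euclideanreal])
       (auto intro!: continuous_intros continuous_map_real_mult_left \<phi> continuous_e)
  moreover have "?K \<subseteq> \<Union> (range G)"
  proof
    fix f assume f: "f \<in> ?K"
    define S where "S = (SUP n. norm (e n f))"
    have bdd: "bdd_above (range (\<lambda>n. norm (e n f)))"
      using e_le f by (intro bdd_aboveI[of _ "N f"]) auto
    \<comment> \<open>The supremum need not be attained; a loss of
      \<open>\<epsilon> / (m * C + 1)\<close> costs less than \<open>\<epsilon>\<close> after
      multiplication by \<open>m * C\<close>, also when that factor is 0.\<close>
    have "S - \<epsilon> / (m * C + 1) < S" using \<open>0 < \<epsilon>\<close> \<open>0 \<le> m\<close> C
      by (simp add: add_nonneg_pos)
    then obtain n where n: "S - \<epsilon> / (m * C + 1) < norm (e n f)"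
      unfolding S_def using less_cSUP_iff[OF _ bdd] by auto
    have mC: "0 \<le> m * C" using \<open>0 \<le> m\<close> C by simp
    have "norm (\<phi> f) \<le> m * N f" using le f by auto
    also have "\<dots> \<le> m * C * S"
      using mult_left_mono[OF N_le \<open>0 \<le> m\<close>, of f] f by (simp add: S_def)
    also have "\<dots> \<le> m * C * (norm (e n f) + \<epsilon> / (m * C + 1))"
      using n mC by (intro mult_left_mono) auto
    also have "\<dots> < m * C * norm (e n f) + \<epsilon>"
      using mC \<open>0 < \<epsilon>\<close> by (simp add: distrib_left divide_less_eq)
    finally have "f \<in> G n" using f W(2) by (auto simp: G_def)
    then show "f \<in> \<Union> (range G)" by blast
  qed
  ultimately obtain \<F> where \<F>: "finite \<F>" "\<F> \<subseteq> range G" "?K \<subseteq> \<Union> \<F>"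
    using compact_ball unfolding compactin_def by (metis (no_types, lifting) imageE)
  then obtain I where I: "finite I" "\<F> = G ` I" by (metis finite_subset_image subset_UNIV)
  \<comment> \<open>\<open>insert 0\<close> and \<open>Suc\<close> make \<open>M\<close> positive in
    any case, so that the index 0 is available when \<open>N f = 0\<close>.\<close>
  define M where "M = Suc (Max (insert 0 I))"
  have M: "n < M" if "n \<in> I" for n
    unfolding M_def less_Suc_eq_le using that I(1) by (intro Max_ge) auto
  show ?thesis
  proof (rule that[of M])
    fix f assume f: "f \<in> W"
    show "\<exists>n<M. norm (\<phi> f) \<le> m * C * norm (e n f) + \<epsilon> * N f"
    proof (cases "N f = 0")
      case True
      then have "norm (\<phi> f) \<le> 0" using le[OF f] by simp
      then show ?thesis using True C \<open>0 \<le> m\<close> by (intro exI[of _ 0]) (auto simp: M_def)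
    next
      case False
      then have pos: "0 < N f" using N_nonneg[OF f] by simp
      define c where "c = inverse (of_real (N f) :: 'k)"
      have c: "norm c = 1 / N f" using pos by (simp add: c_def norm_inverse divide_inverse)
      have cf: "s c f \<in> W" using W(1) f by (rule subspace_scale)
      have "N (s c f) = 1" using N f c pos unfolding seminorm_on_def by simp
      then obtain n where n: "n \<in> I" "s c f \<in> G n" using \<F>(3) I(2) cf by auto
      have "norm (\<phi> (s c f)) = norm (\<phi> f) / N f" "norm (e n (s c f)) = norm (e n f) / N f"
        using \<phi>(1) linear_e[of n] f W(2) c unfolding linear_on_def by (auto simp: norm_mult)
      with n(2) have "norm (\<phi> f) / N f < m * C * (norm (e n f) / N f) + \<epsilon>" by (simp add: G_def)
      then have "norm (\<phi> f) < m * C * norm (e n f) + \<epsilon> * N f" using pos by (simp add: field_simps)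
      then show ?thesis using M[OF n(1)] by (intro exI[of _ n]) auto
    qed
  qed
qed

text \<open>The remainder is again a continuous functional on all of \<open>V\<close>, hence
  eligible for another approximation, while its smallness is measured on \<open>W\<close>
  only.\<close>

lemma functional_approximation:
  fixes \<phi> :: "'v \<Rightarrow> 'k"
  assumes \<phi>: "linear_on s (*) V \<phi>" "continuous_map X euclidean \<phi>"
    and "0 \<le> m" and le: "\<And>f. f \<in> W \<Longrightarrow> norm (\<phi> f) \<le> m * N f" and "0 < \<epsilon>"
  obtains b M where "(\<Sum>n<M. norm (b n)) \<le> m * C" "\<And>n. M \<le> n \<Longrightarrow> b n = 0"
    "linear_on s (*) V (\<lambda>f. \<phi> f - (\<Sum>n<M. b n * e n f))"
    "continuous_map X euclidean (\<lambda>f. \<phi> f - (\<Sum>n<M. b n * e n f))"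
    "\<And>f. f \<in> W \<Longrightarrow> norm (\<phi> f - (\<Sum>n<M. b n * e n f)) \<le> \<epsilon> * N f"
proof -
  obtain M where M: "\<And>f. f \<in> W \<Longrightarrow> \<exists>n<M. norm (\<phi> f) \<le> m * C * norm (e n f) + \<epsilon> * N f"
    using finitely_many_suffice[OF assms] by blast
  have "0 \<le> m * C" using \<open>0 \<le> m\<close> C by simp
  obtain b where b: "(\<Sum>n<M. norm (b n)) \<le> m * C"
    "\<And>f. f \<in> W \<Longrightarrow> norm (\<phi> f - (\<Sum>n<M. b n * e n f)) \<le> \<epsilon> * N f"
    using hahn_banach_decomposition[OF vector_space_axioms W(1) N linear_on_W[OF \<phi>(1)] linear_on_W[OF linear_e]
      \<open>0 \<le> m * C\<close> order_less_imp_le[OF \<open>0 < \<epsilon>\<close>] M] by metis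
  define b' where "b' n = (if n < M then b n else 0)" for n
  have *: "(\<Sum>n<M. norm (b' n)) = (\<Sum>n<M. norm (b n))" "(\<Sum>n<M. b' n * e n f) = (\<Sum>n<M. b n * e n f)" for f
    by (auto simp: b'_def intro!: sum.cong)
  show ?thesis
  proof (rule that[of b' M], unfold *)
    show "linear_on s (*) V (\<lambda>f. \<phi> f - (\<Sum>n<M. b n * e n f))"
      using \<phi>(1) linear_e unfolding linear_on_def
      by (auto simp: distrib_left sum.distrib right_diff_distrib sum_distrib_left mult.left_commute)
    show "continuous_map X euclidean (\<lambda>f. \<phi> f - (\<Sum>n<M. b n * e n f))"
    proof (intro continuous_map_diff continuous_map_sum \<phi>(2) finite_lessThan)
      fix n
      show "continuous_map X euclidean (\<lambda>f. b n * e n f)"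
        using continuous_map_compose[OF continuous_e[of n], of euclidean "(*) (b n)"]
        by (simp add: o_def continuous_on_mult_left)
    qed
  qed (use b in \<open>auto simp: b'_def\<close>)
qed

text \<open>Iterating the approximation with error \<open>m / 2\<^sup>k\<close> turns it into an expansion.\<close>

lemma functional_expansion:
  fixes \<phi> :: "'v \<Rightarrow> 'k"
  assumes \<phi>: "linear_on s (*) V \<phi>" "continuous_map X euclidean \<phi>"
    and "0 \<le> m" and le: "\<And>f. f \<in> W \<Longrightarrow> norm (\<phi> f) \<le> m * N f"
  obtains d where "summable (\<lambda>n. norm (d n))" "(\<Sum>n. norm (d n)) \<le> 2 * m * C"
    "\<And>f. f \<in> W \<Longrightarrow> (\<lambda>n. d n * e n f) sums \<phi> f"
proof (cases "m = 0")
  case True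
  then have "\<phi> f = 0" if "f \<in> W" for f using le[OF that] by simp
  then show ?thesis using that[of "\<lambda>_. 0"] True by simp
next
  case False
  then have "0 < m" using \<open>0 \<le> m\<close> by simp
  \<comment> \<open>\<open>good k\<close> is the invariant of the \<open>k\<close>-th remainder; its
    last clause pins the start of the chosen sequence to \<open>\<phi>\<close>.\<close>
  define good where "good k \<psi> \<longleftrightarrow> linear_on s (*) V \<psi> \<and> continuous_map X euclidean \<psi> \<and>
    (\<forall>f\<in>W. norm (\<psi> f) \<le> m / 2 ^ k * N f) \<and> (k = 0 \<longrightarrow> \<psi> = \<phi>)" for k :: nat and \<psi> :: "'v \<Rightarrow> 'k"
  define step where "step k \<psi> \<psi>' \<longleftrightarrow> (\<exists>b M. (\<Sum>n<M. norm (b n)) \<le> m / 2 ^ k * C \<and> (\<forall>n\<ge>M. b n = 0) \<and>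
    \<psi>' = (\<lambda>f. \<psi> f - (\<Sum>n<M. b n * e n f)))" for k :: nat and \<psi> \<psi>' :: "'v \<Rightarrow> 'k"
  have "\<exists>F. \<forall>k. good k (F k) \<and> step k (F k) (F (Suc k))"
  proof (rule dependent_nat_choice)
    show "\<exists>\<psi>. good 0 \<psi>" using \<phi> le by (auto simp: good_def)
    fix \<psi> k assume \<psi>: "good k \<psi>"
    obtain b M where "(\<Sum>n<M. norm (b n)) \<le> m / 2 ^ k * C" "\<And>n. M \<le> n \<Longrightarrow> b n = 0"
      "linear_on s (*) V (\<lambda>f. \<psi> f - (\<Sum>n<M. b n * e n f))"
      "continuous_map X euclidean (\<lambda>f. \<psi> f - (\<Sum>n<M. b n * e n f))"
      "\<And>f. f \<in> W \<Longrightarrow> norm (\<psi> f - (\<Sum>n<M. b n * e n f)) \<le> m / 2 ^ Suc k * N f"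
      using \<psi> \<open>0 < m\<close> functional_approximation[of \<psi> "m / 2 ^ k" "m / 2 ^ Suc k"]
      unfolding good_def by (smt (verit) divide_pos_pos zero_less_power)
    then show "\<exists>\<psi>'. good (Suc k) \<psi>' \<and> step k \<psi> \<psi>'"
      by (intro exI[of _ "\<lambda>f. \<psi> f - (\<Sum>n<M. b n * e n f)"]) (auto simp: good_def step_def)
  qed
  then obtain F where F: "\<And>k. good k (F k)" "\<And>k. step k (F k) (F (Suc k))" by blast
  define approx where "approx k b M \<longleftrightarrow> (\<Sum>n<M. norm (b n)) \<le> m / 2 ^ k * C \<and> (\<forall>n\<ge>M. b n = 0) \<and>
    F (Suc k) = (\<lambda>f. F k f - (\<Sum>n<M. b n * e n f))" for k b M
  have "\<exists>b M. approx k b M" for k using F(2) unfolding step_def approx_def by blast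
  then obtain b M where "\<And>k. approx k (b k) (M k)" by metis
  then have b: "\<And>k. (\<Sum>n<M k. norm (b k n)) \<le> m / 2 ^ k * C" "\<And>k n. n \<ge> M k \<Longrightarrow> b k n = 0"
    and FS: "\<And>k. F (Suc k) = (\<lambda>f. F k f - (\<Sum>n<M k. b k n * e n f))"
    unfolding approx_def by blast+
  have F0: "F 0 = \<phi>" using F(1)[of 0] by (simp add: good_def)
  \<comment> \<open>Step \<open>k\<close> uses coefficients of total norm at most
    \<open>m / 2 ^ k * C\<close>; the geometric series is the source of the factor 2.\<close>
  define t where "t k = (1 / 2) ^ k * (m * C)" for k :: nat
  have t: "t sums (2 * m * C)"
    unfolding t_def using sums_mult2[OF geometric_sums[of "1 / 2 :: real"], of "m * C"]
    by (simp add: mult.assoc)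
  have fin: "(\<lambda>n. norm (b k n)) sums (\<Sum>n<M k. norm (b k n))" for k
    by (rule sums_finite) (auto simp: b(2))
  have b': "summable (\<lambda>n. norm (b k n))" "(\<Sum>n. norm (b k n)) \<le> t k" for k
    using sums_summable[OF fin] sums_unique[OF fin] b(1)[of k] by (auto simp: t_def power_one_over field_simps)
  show ?thesis
  proof (rule that[of "\<lambda>n. \<Sum>k. b k n"])
    show "summable (\<lambda>n. norm (\<Sum>k. b k n))" "(\<Sum>n. norm (\<Sum>k. b k n)) \<le> 2 * m * C"
      using norm_suminf_swap[OF b' sums_summable[OF t]] sums_unique[OF t] by auto
    fix f assume f: "f \<in> W"
    \<comment> \<open>The corrections are differences of successive remainders, so their series
      telescopes to \<open>\<phi> f\<close> once the remainders tend to 0.\<close>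
    have "(\<lambda>k. F k f) \<longlonglongrightarrow> 0"
    proof (rule Lim_null_comparison)
      show "\<forall>\<^sub>F k in sequentially. norm (F k f) \<le> (1 / 2) ^ k * (m * N f)"
        using F(1) f unfolding good_def by (intro always_eventually) (auto simp: power_one_over field_simps)
      show "(\<lambda>k. (1 / 2) ^ k * (m * N f)) \<longlonglongrightarrow> 0"
        by (intro tendsto_mult_left_zero LIMSEQ_realpow_zero) auto
    qed
    then have "(\<lambda>k. F k f - F (Suc k) f) sums (\<phi> f)"
      using telescope_sums'[of "\<lambda>k. F k f" 0] by (simp add: F0)
    then have "(\<lambda>k. \<Sum>n<M k. b k n * e n f) sums \<phi> f" by (simp add: FS)
    moreover have "(\<lambda>n. b k n * e n f) sums (\<Sum>n<M k. b k n * e n f)" for k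
      by (rule sums_finite) (auto simp: b(2))
    ultimately show "(\<lambda>n. (\<Sum>k. b k n) * e n f) sums \<phi> f"
      by (intro suminf_swap_real_or_complex[OF b' sums_summable[OF t] e_le[OF f]])
  qed
qed

section \<open>Expansion along the nuclear canonical map\<close>

lemma linear_sum:
  assumes "linear_on s (*) V u" "\<And>j. j \<in> J \<Longrightarrow> y j \<in> V"
  shows "u (\<Sum>j\<in>J. y j) = (\<Sum>j\<in>J. u (y j))"
  using assms(2)
proof (induction J rule: infinite_finite_induct)
  case (insert j J)
  then have "u (y j + (\<Sum>j\<in>J. y j)) = u (y j) + u (\<Sum>j\<in>J. y j)"
    using assms(1) subspace_sum[OF subspace, of J y] unfolding linear_on_def by blast
  then show ?case using insert by simp
qed (use linear_zero[OF assms(1)] in simp_all)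

lemma nuclear_domination:
  assumes "nuclear_space s X" "continuous_seminorm s X p"
  obtains l where "\<And>n. 0 \<le> l n" "summable l"
    "\<And>f. f \<in> W \<Longrightarrow> p f \<le> (\<Sum>n. l n * norm (e n f))"
    "\<And>\<mu>. linear_on s (*) V \<mu> \<Longrightarrow> (\<And>f. f \<in> V \<Longrightarrow> norm (\<mu> f) \<le> p f) \<Longrightarrow>
      \<exists>a. (\<forall>n. norm (a n) \<le> l n) \<and> (\<forall>f\<in>W. (\<lambda>n. a n * e n f) sums \<mu> f)"
proof -
  obtain q where q: "continuous_seminorm s X q" and "nuclear_canonical_map s V q p"
    using assms unfolding nuclear_space_def by blast
  then obtain a :: "nat \<Rightarrow> 'v \<Rightarrow> 'k" and \<alpha> :: "nat \<Rightarrow> real" and y :: "nat \<Rightarrow> 'v" where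
    a: "\<And>j. linear_on s (*) V (a j)" "\<And>j f. f \<in> V \<Longrightarrow> norm (a j f) \<le> \<alpha> j * q f"
    and \<alpha>: "\<And>j. 0 \<le> \<alpha> j" and y: "\<And>j. y j \<in> V" and summable: "summable (\<lambda>j. \<alpha> j * p (y j))"
    and lim: "\<And>f. f \<in> V \<Longrightarrow> (\<lambda>n. p (f - (\<Sum>j<n. s (a j f) (y j)))) \<longlonglongrightarrow> 0"
    unfolding nuclear_canonical_map_def by blast
  note p = continuous_seminormD(1)[OF assms(2)]
  \<comment> \<open>\<open>q\<close> is bounded on the compact ball, so \<open>q \<le> L * N\<close>
    on \<open>W\<close>, and the functionals \<open>a j\<close> are bounded for \<open>N\<close>
    with constant \<open>\<alpha> j * L\<close>.\<close>
  have "compact (q ` {f \<in> W. N f \<le> 1})"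
    using image_compactin[OF compact_ball continuous_seminormD(2)[OF q]] by simp
  then obtain L' where L': "\<forall>x\<in>q ` {f \<in> W. N f \<le> 1}. norm x \<le> L'"
    using compact_imp_bounded[THEN bounded_iff[THEN iffD1]] by blast
  define L where "L = \<bar>L'\<bar>"
  have L: "f \<in> W \<Longrightarrow> N f \<le> 1 \<Longrightarrow> q f \<le> L" "0 \<le> L" for f
    using L' by (fastforce simp: L_def)+
  have qN: "q f \<le> L * N f" if "f \<in> W" for f
    using normed.seminorm_le_scale[of q N L f] seminorm_on_W[OF continuous_seminormD(1)[OF q]] N L that by simp
  have aN: "norm (a j f) \<le> \<alpha> j * L * N f" if "f \<in> W" for j f
    using a(2)[of f j] mult_left_mono[OF qN[OF that] \<alpha>[of j]] that W(2) by (auto simp: mult.assoc)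
  define expands where "expands j d \<longleftrightarrow> summable (\<lambda>n. norm (d n)) \<and>
    (\<Sum>n. norm (d n)) \<le> 2 * (\<alpha> j * L) * C \<and> (\<forall>f\<in>W. (\<lambda>n. d n * e n f) sums a j f)" for j d
  have "\<exists>d. expands j d" for j
  proof (rule functional_expansion[of "a j" "\<alpha> j * L", OF a(1) continuous_linear_dominated[OF a(1) q a(2)] _ aN])
    fix d assume "summable (\<lambda>n. norm (d n))" "(\<Sum>n. norm (d n)) \<le> 2 * (\<alpha> j * L) * C"
      "\<And>f. f \<in> W \<Longrightarrow> (\<lambda>n. d n * e n f) sums a j f"
    then show "\<exists>d. expands j d" unfolding expands_def by blast
  qed (use \<alpha> L(2) in auto)
  then obtain d where "\<And>j. expands j (d j)" by metis
  then have d: "summable (\<lambda>n. norm (d j n))" "(\<Sum>n. norm (d j n)) \<le> 2 * (\<alpha> j * L) * C"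
    "f \<in> W \<Longrightarrow> (\<lambda>n. d j n * e n f) sums a j f" for j f unfolding expands_def by blast+
  define t where "t j = 2 * L * C * (\<alpha> j * p (y j))" for j
  have t: "summable t" unfolding t_def using summable by (rule summable_mult)
  have py: "0 \<le> p (y j)" for j using seminorm_nonneg[OF p y] .
  define r where "r j n = p (y j) * norm (d j n)" for j n
  have r: "0 \<le> r j n" "summable (r j)" "suminf (r j) \<le> t j" for j n
  proof -
    show "0 \<le> r j n" using py by (simp add: r_def)
    show "summable (r j)" unfolding r_def using d(1) by (rule summable_mult)
    have "suminf (r j) = p (y j) * (\<Sum>n. norm (d j n))" unfolding r_def using d(1) by (rule suminf_mult)
    also have "\<dots> \<le> p (y j) * (2 * (\<alpha> j * L) * C)" using d(2) py by (rule mult_left_mono)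
    finally show "suminf (r j) \<le> t j" by (simp add: t_def mult_ac)
  qed
  note swap = nonneg_suminf_swap[OF r t]
  define l where "l n = (\<Sum>j. r j n)" for n
  show ?thesis
  proof (rule that[of l])
    show "0 \<le> l n" for n unfolding l_def using swap(1) r(1) by (rule suminf_nonneg)
    show "summable l" unfolding l_def by (rule swap(2))
    show "p f \<le> (\<Sum>n. l n * norm (e n f))" if f: "f \<in> W" for f
    proof -
      have fV: "f \<in> V" using f W(2) by auto
      have sl: "summable (\<lambda>n. l n * norm (e n f))"
        by (rule summable_comparison_test'[OF summable_mult2[OF \<open>summable l\<close>, of "N f"], of 0])
           (use \<open>\<And>n. 0 \<le> l n\<close> e_le[OF f] in \<open>auto intro: mult_left_mono\<close>)
      \<comment> \<open>For each \<open>J\<close>, split \<open>f\<close> into a partial sum of the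
        nuclear series and a remainder; the remainder disappears in the limit over
        \<open>J\<close>.\<close>
      have bound: "p f \<le> (\<Sum>n. l n * norm (e n f)) + p (f - (\<Sum>j<J. s (a j f) (y j)))" for J
      proof -
        have "p (\<Sum>j\<in>I. s (a j f) (y j)) \<le> (\<Sum>j\<in>I. norm (a j f) * p (y j))" for I
        proof (induction I rule: infinite_finite_induct)
          case (insert j I)
          have "p (s (a j f) (y j) + (\<Sum>j\<in>I. s (a j f) (y j)))
              \<le> p (s (a j f) (y j)) + p (\<Sum>j\<in>I. s (a j f) (y j))"
            using p y subspace_sum[OF subspace, of I "\<lambda>j. s (a j f) (y j)"] unfolding seminorm_on_def by blast
          moreover have "p (s (a j f) (y j)) = norm (a j f) * p (y j)"
            using p y unfolding seminorm_on_def by blast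
          ultimately show ?case using insert by simp
        qed (use p in simp_all)
        also have "(\<Sum>j<J. norm (a j f) * p (y j)) \<le> (\<Sum>n. l n * norm (e n f))"
        proof -
          have sr: "summable (\<lambda>n. r j n * norm (e n f))" for j
            by (rule summable_comparison_test'[OF summable_mult2[OF r(2)[of j], of "N f"], of 0])
               (use r(1) e_le[OF f] in \<open>auto intro: mult_left_mono\<close>)
          have "norm (a j f) * p (y j) \<le> (\<Sum>n. r j n * norm (e n f))" for j
          proof -
            \<comment> \<open>Multiplying the expansion of \<open>a j\<close> by
              \<open>p (y j)\<close> as a scalar turns the norms of its coefficients into
              \<open>r j n\<close>.\<close>
            have "(\<lambda>n. of_real (p (y j)) * (d j n * e n f)) sums (of_real (p (y j)) * a j f)"
              by (intro sums_mult d(3) f)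
            from norm_sums_le[OF this summable_sums[OF sr]] show ?thesis
              using py by (simp add: r_def norm_mult mult_ac)
          qed
          then have "(\<Sum>j<J. norm (a j f) * p (y j)) \<le> (\<Sum>j<J. \<Sum>n. r j n * norm (e n f))"
            by (rule sum_mono)
          also have "\<dots> = (\<Sum>n. \<Sum>j<J. r j n * norm (e n f))"
            by (rule suminf_sum[symmetric]) (rule sr)
          also have "\<dots> \<le> (\<Sum>n. l n * norm (e n f))"
          proof (rule suminf_le[OF _ summable_sum sl])
            show "(\<Sum>j<J. r j n * norm (e n f)) \<le> l n * norm (e n f)" for n
              unfolding sum_distrib_right[symmetric] l_def
              by (intro mult_right_mono sum_le_suminf swap(1)) (auto intro: r)
          qed (rule sr)
          finally show ?thesis .
        qed
        finally show ?thesis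
          using seminorm_diff_le(2)[OF p fV, of "\<Sum>j<J. s (a j f) (y j)"]
            subspace_sum[OF subspace, of "{..<J}" "\<lambda>j. s (a j f) (y j)"] y by force
      qed
      have "(\<lambda>J. (\<Sum>n. l n * norm (e n f)) + p (f - (\<Sum>j<J. s (a j f) (y j))))
          \<longlonglongrightarrow> (\<Sum>n. l n * norm (e n f)) + 0"
        by (intro tendsto_add tendsto_const lim fV)
      from LIMSEQ_le_const[OF this] bound show ?thesis by simp
    qed
    show "\<exists>a. (\<forall>n. norm (a n) \<le> l n) \<and> (\<forall>f\<in>W. (\<lambda>n. a n * e n f) sums \<mu> f)"
      if \<mu>: "linear_on s (*) V \<mu>" "\<And>f. f \<in> V \<Longrightarrow> norm (\<mu> f) \<le> p f" for \<mu>
    proof -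
      \<comment> \<open>Applying \<open>\<mu>\<close> to the nuclear series and expanding each
        \<open>a j\<close> gives these coefficients; \<open>norm (\<mu> (y j)) \<le> p (y j)\<close>
        keeps them below \<open>r j n\<close>.\<close>
      define g where "g j n = \<mu> (y j) * d j n" for j n
      have gr: "norm (g j n) \<le> r j n" for j n
        unfolding g_def r_def norm_mult using \<mu>(2)[OF y] by (rule mult_right_mono) simp
      have g: "summable (\<lambda>n. norm (g j n))" for j
        by (rule summable_comparison_test'[OF r(2)[of j], of 0]) (use gr in auto)
      have g': "(\<Sum>n. norm (g j n)) \<le> t j" for j
        by (rule order_trans[OF suminf_le[OF gr g r(2)] r(3)])
      note gswap = norm_suminf_swap[OF g g' t]
      show ?thesis
      proof (intro exI[of _ "\<lambda>n. \<Sum>j. g j n"] conjI allI ballI)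
        show "norm (\<Sum>j. g j n) \<le> l n" for n
          unfolding l_def by (rule norm_sums_le[OF summable_sums[OF gswap(1)] summable_sums[OF swap(1)] gr])
        fix f assume f: "f \<in> W"
        then have fV: "f \<in> V" using W(2) by auto
        have "(\<lambda>J. \<mu> f - (\<Sum>j<J. \<mu> (y j) * a j f)) \<longlonglongrightarrow> 0"
        proof (rule Lim_null_comparison[OF always_eventually lim[OF fV]], rule allI)
          fix J
          have "\<mu> (\<Sum>j<J. s (a j f) (y j)) = (\<Sum>j<J. \<mu> (y j) * a j f)"
            using \<mu>(1) y by (subst linear_sum) (auto simp: linear_on_def mult.commute)
          then show "norm (\<mu> f - (\<Sum>j<J. \<mu> (y j) * a j f)) \<le> p (f - (\<Sum>j<J. s (a j f) (y j)))"
            using \<mu>(2)[of "f - (\<Sum>j<J. s (a j f) (y j))"] y fV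
              linear_diff[OF \<mu>(1) fV, of "\<Sum>j<J. s (a j f) (y j)"]
            by (simp add: subspace_sum[OF subspace])
        qed
        then have "(\<lambda>j. \<mu> (y j) * a j f) sums \<mu> f"
          unfolding sums_def using tendsto_diff[OF tendsto_const[of "\<mu> f"]] by fastforce
        moreover have "(\<lambda>n. g j n * e n f) sums (\<mu> (y j) * a j f)" for j
          unfolding g_def mult.assoc by (intro sums_mult d(3) f)
        ultimately show "(\<lambda>n. (\<Sum>j. g j n) * e n f) sums \<mu> f"
          by (intro suminf_swap_real_or_complex[OF g g' t e_le[OF f]])
      qed
    qed
  qed
qed

end

section \<open>One dominating sequence for all seminorms, and convergence in the dual of
  \<open>W\<close>\<close>

context fixing_functionals
begin

lemma uniform_nuclear_domination:
  assumes "metrizable_space X" "nuclear_space s X"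
  obtains l where "\<And>n. 0 < l n" "summable l"
    "\<And>p. continuous_seminorm s X p \<Longrightarrow> \<exists>C\<ge>1. (\<forall>f\<in>W. p f \<le> C * (\<Sum>n. l n * norm (e n f))) \<and>
      (\<forall>\<mu>. linear_on s (*) V \<mu> \<longrightarrow> (\<forall>f\<in>V. norm (\<mu> f) \<le> p f) \<longrightarrow>
        (\<exists>a. (\<forall>n. norm (a n) \<le> C * l n) \<and> (\<forall>f\<in>W. (\<lambda>n. a n * e n f) sums \<mu> f)))"
proof -
  define dominates where "dominates p l \<longleftrightarrow> (\<forall>n. 0 \<le> l n) \<and> summable l \<and>
    (\<forall>f\<in>W. p f \<le> (\<Sum>n. l n * norm (e n f))) \<and>
    (\<forall>\<mu>. linear_on s (*) V \<mu> \<longrightarrow> (\<forall>f\<in>V. norm (\<mu> f) \<le> p f) \<longrightarrow>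
      (\<exists>a. (\<forall>n. norm (a n) \<le> l n) \<and> (\<forall>f\<in>W. (\<lambda>n. a n * e n f) sums \<mu> f)))" for p l
  have ex: "\<exists>l. dominates p l" if "continuous_seminorm s X p" for p
  proof (rule nuclear_domination[OF assms(2) that])
    fix l assume "\<And>n. 0 \<le> l n" "summable l" "\<And>f. f \<in> W \<Longrightarrow> p f \<le> (\<Sum>n. l n * norm (e n f))"
      "\<And>\<mu>. linear_on s (*) V \<mu> \<Longrightarrow> (\<And>f. f \<in> V \<Longrightarrow> norm (\<mu> f) \<le> p f) \<Longrightarrow>
        \<exists>a. (\<forall>n. norm (a n) \<le> l n) \<and> (\<forall>f\<in>W. (\<lambda>n. a n * e n f) sums \<mu> f)"
    then show "\<exists>l. dominates p l" unfolding dominates_def by blast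
  qed
  obtain q :: "nat \<Rightarrow> 'v \<Rightarrow> real" where q: "\<And>k. continuous_seminorm s X (q k)"
    and "\<And>k l f. f \<in> V \<Longrightarrow> k \<le> l \<Longrightarrow> q k f \<le> q l f"
    and fund: "\<And>p. continuous_seminorm s X p \<Longrightarrow> \<exists>k. \<forall>f\<in>V. p f \<le> q k f"
    using fundamental_seminorms[OF assms(1)] by blast
  obtain L where L: "\<And>k. dominates (q k) (L k)" using ex[OF q] by metis
  have L': "0 \<le> L k n" "summable (L k)" for k n using L unfolding dominates_def by auto
  have Lpos: "0 < 1 + suminf (L k)" for k using suminf_nonneg[OF L'(2,1), of k] by simp
  \<comment> \<open>The denominator normalises the sum of \<open>L k\<close>, with 1 added to keep
    it positive; the factor \<open>(1 / 2) ^ k\<close> makes the double series converge.\<close>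
  define r where "r k n = (1 / 2) ^ k / (1 + suminf (L k)) * L k n" for k n
  have r: "0 \<le> r k n" "summable (r k)" "suminf (r k) \<le> (1 / 2) ^ k" for k n
  proof -
    show "0 \<le> r k n" unfolding r_def using Lpos[of k] L' by simp
    show "summable (r k)" unfolding r_def using L'(2) by (rule summable_mult)
    have "suminf (r k) = (1 / 2) ^ k / (1 + suminf (L k)) * suminf (L k)"
      unfolding r_def using L'(2) by (rule suminf_mult)
    also have "\<dots> = (1 / 2) ^ k * (suminf (L k) / (1 + suminf (L k)))" by simp
    also have "\<dots> \<le> (1 / 2) ^ k * 1" using Lpos[of k] by (intro mult_left_mono) (auto simp: divide_le_eq)
    finally show "suminf (r k) \<le> (1 / 2) ^ k" by simp
  qed
  note swap = nonneg_suminf_swap[OF r summable_geometric, simplified]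
  \<comment> \<open>The summand \<open>(1 / 2) ^ n\<close> forces strict positivity.\<close>
  define l where "l n = (1 / 2) ^ n + (\<Sum>k. r k n)" for n
  have Ll: "L k n \<le> 2 ^ k * (1 + suminf (L k)) * l n" for k n
  proof -
    have "r k n \<le> (\<Sum>k. r k n)" using sum_le_suminf[OF swap(1)[of n], of "{k}"] r(1) by simp
    also have "\<dots> \<le> l n" by (simp add: l_def)
    finally have "L k n / (2 ^ k * (1 + suminf (L k))) \<le> l n" by (simp add: r_def power_divide)
    moreover have "0 < 2 ^ k * (1 + suminf (L k))" using Lpos[of k] by simp
    ultimately show ?thesis by (simp only: pos_divide_le_eq mult.commute)
  qed
  show ?thesis
  proof (rule that[of l])
    show "0 < l n" for n
      unfolding l_def using suminf_nonneg[OF swap(1) r(1)] by (intro add_pos_nonneg) auto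
    show sl: "summable l" unfolding l_def by (intro summable_add summable_geometric swap(2)) simp
    fix p assume "continuous_seminorm s X p"
    then obtain k where k: "\<forall>f\<in>V. p f \<le> q k f" using fund by blast
    \<comment> \<open>Reciprocal of the weight that \<open>r\<close> gives to the
      \<open>k\<close>-th seminorm.\<close>
    define C where "C = 2 ^ k * (1 + suminf (L k))"
    have LC: "L k n \<le> C * l n" for n unfolding C_def by (rule Ll)
    have "1 * 1 \<le> C" unfolding C_def
      using suminf_nonneg[OF L'(2,1), of k] by (intro mult_mono) auto
    moreover have "p f \<le> C * (\<Sum>n. l n * norm (e n f))" if f: "f \<in> W" for f
    proof -
      have s: "summable (\<lambda>n. h n * norm (e n f))" if "summable h" "\<And>n. 0 \<le> h n" for h :: "nat \<Rightarrow> real"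
        by (rule summable_comparison_test'[OF summable_mult2[OF that(1), of "N f"], of 0])
           (use that(2) e_le[OF f] in \<open>auto intro: mult_left_mono\<close>)
      have sl': "summable (\<lambda>n. l n * norm (e n f))" by (rule s[OF sl]) (simp add: \<open>\<And>n. 0 < l n\<close> less_imp_le)
      have "p f \<le> (\<Sum>n. L k n * norm (e n f))"
        using k L[of k] f W(2) unfolding dominates_def by (meson order_trans subsetD)
      also have "\<dots> \<le> (\<Sum>n. C * (l n * norm (e n f)))"
        unfolding mult.assoc[symmetric]
        by (rule suminf_le[OF mult_right_mono[OF LC] s[OF L'(2,1)]])
           (use summable_mult[OF sl', of C] in \<open>simp_all add: mult.assoc\<close>)
      also have "\<dots> = C * (\<Sum>n. l n * norm (e n f))" using sl' by (rule suminf_mult)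
      finally show ?thesis .
    qed
    moreover have "\<exists>a. (\<forall>n. norm (a n) \<le> C * l n) \<and> (\<forall>f\<in>W. (\<lambda>n. a n * e n f) sums \<mu> f)"
      if \<mu>: "linear_on s (*) V \<mu>" "\<forall>f\<in>V. norm (\<mu> f) \<le> p f" for \<mu>
    proof -
      have "\<forall>f\<in>V. norm (\<mu> f) \<le> q k f" using \<mu>(2) k by force
      then obtain a where "\<forall>n. norm (a n) \<le> L k n" "\<forall>f\<in>W. (\<lambda>n. a n * e n f) sums \<mu> f"
        using L[of k] \<mu>(1) unfolding dominates_def by blast
      then show ?thesis using LC order_trans by blast
    qed
    ultimately show "\<exists>C\<ge>1. (\<forall>f\<in>W. p f \<le> C * (\<Sum>n. l n * norm (e n f))) \<and>
      (\<forall>\<mu>. linear_on s (*) V \<mu> \<longrightarrow> (\<forall>f\<in>V. norm (\<mu> f) \<le> p f) \<longrightarrow>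
        (\<exists>a. (\<forall>n. norm (a n) \<le> C * l n) \<and> (\<forall>f\<in>W. (\<lambda>n. a n * e n f) sums \<mu> f)))"
      by auto
  qed
qed

lemma dual_normI:
  assumes "linear_on s (*) W u" "\<And>f. f \<in> W \<Longrightarrow> norm (u f) \<le> c * N f" "\<And>f. f \<notin> W \<Longrightarrow> u f = 0"
  shows "u \<in> dual s (norm_topology W N)"
  using normed.continuous_linear_dominated[OF _ continuous_seminorm_N, of u c] assms
  by (auto simp: dual_def)

text \<open>The remainder of the series is at most the tail of \<open>norm (a n)\<close> times
  \<open>N\<close>, hence uniformly small on bounded sets. Partial sums are extended by 0 outside
  \<open>W\<close>, as elements of \<open>dual\<close> must be.\<close>

lemma limitin_strong_dual_norm:
  assumes a: "summable (\<lambda>n. norm (a n))" and \<phi>: "linear_on s (*) W \<phi>" "\<And>f. f \<notin> W \<Longrightarrow> \<phi> f = 0"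
    and sums: "\<And>f. f \<in> W \<Longrightarrow> (\<lambda>n. a n * e n f) sums \<phi> f"
  shows "\<phi> \<in> dual s (norm_topology W N)"
    "limitin (strong_dual s (norm_topology W N)) (\<lambda>m. zero_ext W (\<lambda>f. \<Sum>n<m. a n * e n f)) \<phi> sequentially"
proof -
  have an: "norm (a n * e n f) \<le> norm (a n) * N f" if "f \<in> W" for n f
    unfolding norm_mult by (rule mult_left_mono[OF e_le[OF that]]) simp
  show dual: "\<phi> \<in> dual s (norm_topology W N)"
  proof (rule dual_normI[OF \<phi>(1) _ \<phi>(2)])
    show "norm (\<phi> f) \<le> (\<Sum>n. norm (a n)) * N f" if "f \<in> W" for f
      using norm_sums_le[OF sums[OF that] sums_mult2[OF summable_sums[OF a]] an[OF that]] .
  qed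
  show "limitin (strong_dual s (norm_topology W N)) (\<lambda>m. zero_ext W (\<lambda>f. \<Sum>n<m. a n * e n f)) \<phi> sequentially"
  proof (rule normed.limitin_strong_dual[OF _ dual continuous_seminorm_N suminf_exist_split2[OF a]])
    fix m
    have "norm (\<Sum>n<m. a n * e n f) \<le> (\<Sum>n<m. norm (a n)) * N f" if "f \<in> W" for f
      unfolding sum_distrib_right by (rule sum_norm_le) (rule an[OF that])
    moreover have "linear_on s (*) W (zero_ext W (\<lambda>f. \<Sum>n<m. a n * e n f))"
      using W linear_on_W[OF linear_e] unfolding linear_on_def zero_ext_def
      by (auto simp: distrib_left sum.distrib sum_distrib_left mult.left_commute subspace_add subspace_scale)
    ultimately show "zero_ext W (\<lambda>f. \<Sum>n<m. a n * e n f) \<in> dual s (norm_topology W N)"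
      by (intro dual_normI[of _ "\<Sum>n<m. norm (a n)"]) (auto simp: zero_ext_def)
    fix f assume "f \<in> topspace (norm_topology W N)"
    then have f: "f \<in> W" by simp
    have "(\<lambda>n. a (n + m) * e (n + m) f) sums (\<phi> f - (\<Sum>n<m. a n * e n f))"
      using sums_split_initial_segment[OF sums[OF f]] .
    moreover have "(\<lambda>n. norm (a (n + m)) * N f) sums ((\<Sum>n. norm (a (n + m))) * N f)"
      using a by (intro sums_mult2 summable_sums) (simp add: summable_iff_shift[of "\<lambda>n. norm (a n)"])
    ultimately have "norm (\<phi> f - (\<Sum>n<m. a n * e n f)) \<le> (\<Sum>n. norm (a (n + m))) * N f"
      by (rule norm_sums_le) (rule an[OF f])
    then show "norm (zero_ext W (\<lambda>f. \<Sum>n<m. a n * e n f) f - \<phi> f) \<le> (\<Sum>n. norm (a (n + m))) * N f"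
      using f by (simp add: zero_ext_def norm_minus_commute)
  qed
qed

end

section \<open>Application to F(\<Omega>) and \<F>\<nu>(\<Omega>)\<close>

lemma sum_fun_apply: "(\<Sum>i\<in>I. g i) x = (\<Sum>i\<in>I. g i x)" for g :: "'i \<Rightarrow> 'a \<Rightarrow> 'b::comm_monoid_add"
  by (induction I rule: infinite_finite_induct) auto

theorem theorem5p5p1:
  fixes s :: "'k::real_or_complex \<Rightarrow> 'e::ab_group_add \<Rightarrow> 'e"
    and \<nu> :: "'w \<Rightarrow> real"
    and K :: "('o, 'w, 'k) fun_data"
    and D :: "'e set \<Rightarrow> ('e \<Rightarrow> real) \<Rightarrow> ('o, 'w, 'e) fun_data"
    and x :: "nat \<Rightarrow> 'w"
  assumes "vector_space s"
    and "\<And>t. 0 < \<nu> t"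
    and "admissible_family s \<nu> K D"
    and "frechet_space (fscale (*)) (top_F K)"
    and "nuclear_space (fscale (*)) (top_F K)"
    and "banach_space (fscale (*)) (Fnu norm \<nu> K) (Fnu_norm norm \<nu> K)"
    and "compactin (top_F K) {f \<in> Fnu norm \<nu> K. Fnu_norm norm \<nu> K f \<le> 1}"
    and "fixes_topology \<nu> K x"
  shows "(\<exists>l :: nat \<Rightarrow> real. summable l \<and> (\<forall>n. 0 < l n) \<and>
      (\<forall>B. tvs_bounded (fscale (*)) (strong_dual (fscale (*)) (top_F K)) B \<longrightarrow>
        (\<exists>C\<ge>1. {zero_ext (Fnu norm \<nu> K) \<mu> | \<mu>. \<mu> \<in> B} \<subseteq>
          {\<phi> \<in> dual (fscale (*)) (Fnu_topology norm \<nu> K). \<exists>a :: nat \<Rightarrow> 'k.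
             summable (\<lambda>n. norm (a n)) \<and> (\<forall>n. norm (a n) \<le> C * l n) \<and>
             limitin (strong_dual (fscale (*)) (Fnu_topology norm \<nu> K))
               (\<lambda>m. \<Sum>n<m. fscale (*) (a n * of_real (\<nu> (x n))) (T_at K (Fnu norm \<nu> K) (x n)))
               \<phi> sequentially})))
    \<and> (\<forall>p :: nat \<Rightarrow> ('o \<Rightarrow> 'k) \<Rightarrow> real.
      (\<forall>k. seminorm_on (fscale (*)) (F_space K) (p k)) \<and>
      top_F K = seminorm_topology (F_space K) (range p) \<longrightarrow>
      (\<exists>\<epsilon> :: nat \<Rightarrow> real. decseq \<epsilon> \<and> \<epsilon> \<longlonglongrightarrow> 0 \<and>
        (\<forall>k. \<exists>C\<ge>1. \<forall>f \<in> Fnu norm \<nu> K.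
          p k f \<le> C * (SUP n. norm (op_T K f (x n)) * \<nu> (x n) * \<epsilon> n))))"
proof -
  let ?s = "fscale (*) :: 'k \<Rightarrow> ('o \<Rightarrow> 'k) \<Rightarrow> 'o \<Rightarrow> 'k"
  let ?X = "top_F K" and ?W = "Fnu norm \<nu> K" and ?N = "Fnu_norm norm \<nu> K"
  \<comment> \<open>Formed on all of F(\<Omega>), where \<open>T_at\<close> is continuous; on
    \<open>?W\<close> it is the weighted value of \<open>op_T K f\<close> at
    \<open>x n\<close>.\<close>
  define e where "e n f = of_real (\<nu> (x n)) * T_at K (F_space K) (x n) f" for n f
  have \<nu>: "0 \<le> \<nu> t" for t using assms(2)[of t] by simp
  have vs: "vector_space ?s"
    by (intro vector_space_fscale) (rule vector_space_over_itself.vector_space_axioms)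
  have lc: "lcHs ?s ?X" and topspace: "topspace ?X = F_space K"
    and consistent: "consistent K (*) UNIV norm K"
    using assms(3) by (auto simp: admissible_family_def fun_setting_def)
  \<comment> \<open>Consistency places \<open>T_at\<close> in the dual only under a quantifier over
    the \<epsilon>-product; the zero map provides an instance.\<close>
  have "(\<lambda>_. 0) \<in> eps_product ?s ?X (*) (UNIV :: 'k set) norm"
    by (auto simp: eps_product_def linear_on_def)
  then have T: "T_at K (F_space K) t \<in> dual ?s ?X" for t
    using consistent unfolding consistent_def by blast
  have WF: "?W \<subseteq> F_space K" by (auto simp: Fnu_def)
  have e_eq: "e n f = of_real (\<nu> (x n)) * op_T K f (x n)" if "f \<in> ?W" for n f
    using that WF by (auto simp: e_def T_at_def zero_ext_def)
  have norm_e: "norm (e n f) = norm (op_T K f (x n)) * \<nu> (x n)" if "f \<in> ?W" for n f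
    using \<nu>[of "x n"] by (simp add: e_eq[OF that] norm_mult mult.commute)
  obtain C where C: "0 < C" "\<And>f. f \<in> ?W \<Longrightarrow> ?N f \<le> C * (SUP n. norm (op_T K f (x n)) * \<nu> (x n))"
    using assms(8) unfolding fixes_topology_def by blast
  interpret fixing_functionals ?s ?X ?W ?N e C
  proof (intro fixing_functionals.intro locally_convex.intro vs
      locally_convex_axioms.intro fixing_functionals_axioms.intro)
    show "module.subspace ?s (topspace ?X)"
      "\<exists>P. (\<forall>p\<in>P. seminorm_on ?s (topspace ?X) p) \<and> ?X = seminorm_topology (topspace ?X) P"
      using lc by (auto simp: lcHs_def)
    show "module.subspace ?s ?W" "seminorm_on ?s ?W ?N" using assms(6) by (auto simp: banach_space_def)
    show "?W \<subseteq> topspace ?X" using WF topspace by simp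
    show "compactin ?X {f \<in> ?W. ?N f \<le> 1}" by (rule assms(7))
    show "linear_on ?s (*) (topspace ?X) (e n)" for n
      using T[of "x n"] by (auto simp: dual_def linear_on_def e_def distrib_left)
    have "continuous_map ?X euclidean (T_at K (F_space K) (x n))" for n
      using T by (auto simp: dual_def)
    from continuous_map_compose[OF this, of euclidean "(*) (of_real (\<nu> (x n)))" for n]
    show "continuous_map ?X euclidean (e n)" for n
      by (simp add: o_def e_def[abs_def] continuous_on_mult_left)
    show "norm (e n f) \<le> ?N f" if "f \<in> ?W" for n f
      unfolding norm_e[OF that] Fnu_norm_def using that by (intro cSUP_upper) (auto simp: Fnu_def)
    show "0 < C" by (rule C)
    show "?N f \<le> C * (SUP n. norm (e n f))" if "f \<in> ?W" for f using C(2)[OF that] by (simp add: norm_e[OF that])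
  qed
  have metrizable: "metrizable_space ?X" using assms(4) by (simp add: frechet_space_def)
  obtain l where l: "\<And>n. 0 < l n" "summable l"
    and dom: "\<And>p. continuous_seminorm ?s ?X p \<Longrightarrow> \<exists>C\<ge>1. (\<forall>f\<in>?W. p f \<le> C * (\<Sum>n. l n * norm (e n f))) \<and>
      (\<forall>\<mu>. linear_on ?s (*) (topspace ?X) \<mu> \<longrightarrow> (\<forall>f\<in>topspace ?X. norm (\<mu> f) \<le> p f) \<longrightarrow>
        (\<exists>a. (\<forall>n. norm (a n) \<le> C * l n) \<and> (\<forall>f\<in>?W. (\<lambda>n. a n * e n f) sums \<mu> f)))"
    using uniform_nuclear_domination[OF metrizable assms(5)] by blast
  have partial_sum: "(\<Sum>n<m. fscale (*) (a n * of_real (\<nu> (x n))) (T_at K ?W (x n))) = zero_ext ?W (\<lambda>f. \<Sum>n<m. a n * e n f)"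
    for a m
    by (rule ext) (auto simp: sum_fun_apply fscale_def T_at_def zero_ext_def e_eq mult.assoc intro!: sum.cong)
  show ?thesis
  proof (intro conjI allI impI)
    show "\<exists>l :: nat \<Rightarrow> real. summable l \<and> (\<forall>n. 0 < l n) \<and>
      (\<forall>B. tvs_bounded (fscale (*)) (strong_dual ?s ?X) B \<longrightarrow>
        (\<exists>C\<ge>1. {zero_ext ?W \<mu> | \<mu>. \<mu> \<in> B} \<subseteq>
          {\<phi> \<in> dual ?s (Fnu_topology norm \<nu> K). \<exists>a :: nat \<Rightarrow> 'k.
             summable (\<lambda>n. norm (a n)) \<and> (\<forall>n. norm (a n) \<le> C * l n) \<and>
             limitin (strong_dual ?s (Fnu_topology norm \<nu> K))
               (\<lambda>m. \<Sum>n<m. fscale (*) (a n * of_real (\<nu> (x n))) (T_at K ?W (x n)))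
               \<phi> sequentially}))"
    proof (intro exI[of _ l] conjI allI impI l)
      fix B assume B: "tvs_bounded (fscale (*)) (strong_dual ?s ?X) B"
      have BD: "B \<subseteq> dual ?s ?X"
        using B by (simp add: tvs_bounded_def strong_dual_def uniform_topology_def)
      obtain p where p: "continuous_seminorm ?s ?X p" "\<And>\<mu> f. \<mu> \<in> B \<Longrightarrow> f \<in> topspace ?X \<Longrightarrow> norm (\<mu> f) \<le> p f"
        using strong_dual_bounded_dominated[OF metrizable B] by blast
      obtain C where C: "1 \<le> C" and rep: "\<forall>\<mu>. linear_on ?s (*) (topspace ?X) \<mu> \<longrightarrow>
        (\<forall>f\<in>topspace ?X. norm (\<mu> f) \<le> p f) \<longrightarrow>
        (\<exists>a. (\<forall>n. norm (a n) \<le> C * l n) \<and> (\<forall>f\<in>?W. (\<lambda>n. a n * e n f) sums \<mu> f))"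
        using dom[OF p(1)] by (elim exE conjE) (rule that)
      show "\<exists>C\<ge>1. {zero_ext ?W \<mu> | \<mu>. \<mu> \<in> B} \<subseteq>
          {\<phi> \<in> dual ?s (Fnu_topology norm \<nu> K). \<exists>a :: nat \<Rightarrow> 'k.
             summable (\<lambda>n. norm (a n)) \<and> (\<forall>n. norm (a n) \<le> C * l n) \<and>
             limitin (strong_dual ?s (Fnu_topology norm \<nu> K))
               (\<lambda>m. \<Sum>n<m. fscale (*) (a n * of_real (\<nu> (x n))) (T_at K ?W (x n)))
               \<phi> sequentially}"
      proof (intro exI[of _ C] conjI C subsetI, elim CollectE exE conjE)
        fix \<phi> \<mu> assume \<mu>: "\<phi> = zero_ext ?W \<mu>" "\<mu> \<in> B"
        have lin: "linear_on ?s (*) (topspace ?X) \<mu>" using \<mu>(2) BD by (auto simp: dual_def)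
        obtain a where a: "\<And>n. norm (a n) \<le> C * l n" "\<And>f. f \<in> ?W \<Longrightarrow> (\<lambda>n. a n * e n f) sums \<mu> f"
          using rep[rule_format, OF lin p(2)[OF \<mu>(2)]] by blast
        have sa: "summable (\<lambda>n. norm (a n))"
          by (rule summable_comparison_test'[OF summable_mult[OF l(2), of C], of 0]) (use a(1) in auto)
        have "linear_on ?s (*) ?W \<phi>"
          unfolding \<mu>(1) using linear_on_W[OF lin] W(1)
          by (auto simp: linear_on_def zero_ext_def subspace_add subspace_scale)
        note lim = limitin_strong_dual_norm[OF sa this, unfolded partial_sum[symmetric]]
        show "\<phi> \<in> {\<phi> \<in> dual ?s (Fnu_topology norm \<nu> K). \<exists>a :: nat \<Rightarrow> 'k.
             summable (\<lambda>n. norm (a n)) \<and> (\<forall>n. norm (a n) \<le> C * l n) \<and>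
             limitin (strong_dual ?s (Fnu_topology norm \<nu> K))
               (\<lambda>m. \<Sum>n<m. fscale (*) (a n * of_real (\<nu> (x n))) (T_at K ?W (x n)))
               \<phi> sequentially}"
          using a sa \<mu>(1) by (intro CollectI conjI exI[of _ a] lim allI) (auto simp: zero_ext_def)
      qed
    qed
  next
    fix p :: "nat \<Rightarrow> ('o \<Rightarrow> 'k) \<Rightarrow> real"
    assume p: "(\<forall>k. seminorm_on ?s (F_space K) (p k)) \<and> ?X = seminorm_topology (F_space K) (range p)"
    \<comment> \<open>Chosen from \<open>l\<close> alone, before \<open>k\<close> is fixed, so one
      sequence serves all seminorms.\<close>
    obtain \<epsilon> where \<epsilon>: "decseq \<epsilon>" "\<epsilon> \<longlonglongrightarrow> 0" "\<And>n. 0 < \<epsilon> n" "summable (\<lambda>n. l n / \<epsilon> n)"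
      using summable_divide_sqrt_tail[OF l(2,1)] by blast
    have l\<epsilon>: "0 \<le> l n / \<epsilon> n" for n using l(1)[of n] \<epsilon>(3)[of n] by simp
    show "\<exists>\<epsilon> :: nat \<Rightarrow> real. decseq \<epsilon> \<and> \<epsilon> \<longlonglongrightarrow> 0 \<and>
        (\<forall>k. \<exists>C\<ge>1. \<forall>f \<in> ?W. p k f \<le> C * (SUP n. norm (op_T K f (x n)) * \<nu> (x n) * \<epsilon> n))"
    proof (intro exI[of _ \<epsilon>] conjI allI \<epsilon>)
      fix k
      have "continuous_seminorm ?s ?X (p k)"
        by (rule continuous_seminorm_generating[of "range p"]) (use p topspace in auto)
      from dom[OF this] obtain C where
        C: "1 \<le> C" "\<forall>f\<in>?W. p k f \<le> C * (\<Sum>n. l n * norm (e n f))"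
        by (elim exE conjE) (rule that)
      \<comment> \<open>Adding 1 to the sum secures \<open>C' \<ge> 1\<close>.\<close>
      define C' where "C' = C * (1 + (\<Sum>n. l n / \<epsilon> n))"
      have "1 * 1 \<le> C'"
        unfolding C'_def using C(1) suminf_nonneg[OF \<epsilon>(4) l\<epsilon>] by (intro mult_mono) auto
      moreover have "p k f \<le> C' * (SUP n. norm (op_T K f (x n)) * \<nu> (x n) * \<epsilon> n)" if f: "f \<in> ?W" for f
      proof -
        define S where "S = (SUP n. norm (e n f) * \<epsilon> n)"
        \<comment> \<open>The supremum is finite: \<open>\<epsilon>\<close> is decreasing and
          \<open>norm (e n f) \<le> ?N f\<close>, so every term is at most
          \<open>?N f * \<epsilon> 0\<close>.\<close>
        have upper: "norm (e n f) * \<epsilon> n \<le> S" for n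
          unfolding S_def
        proof (rule cSUP_upper)
          have "norm (e n f) * \<epsilon> n \<le> ?N f * \<epsilon> 0" for n
            using e_le[OF f] decseqD[OF \<epsilon>(1), of 0 n] \<epsilon>(3)[of n] N_nonneg[OF f] by (intro mult_mono) auto
          then show "bdd_above (range (\<lambda>n. norm (e n f) * \<epsilon> n))" by (rule bdd_aboveI2)
        qed simp
        have S: "0 \<le> S" using upper[of 0] \<epsilon>(3)[of 0] by (meson mult_nonneg_nonneg norm_ge_zero less_imp_le order_trans)
        \<comment> \<open>Splitting \<open>l n\<close> as \<open>l n / \<epsilon> n\<close> times
          \<open>\<epsilon> n\<close> leaves a summable factor and one that, with
          \<open>norm (e n f)\<close>, is bounded by \<open>S\<close>.\<close>
        have le: "l n * norm (e n f) \<le> l n / \<epsilon> n * S" for n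
          using mult_left_mono[OF upper[of n] l\<epsilon>[of n]] \<epsilon>(3)[of n] by simp
        have "summable (\<lambda>n. l n * norm (e n f))"
          by (rule summable_comparison_test'[OF summable_mult2[OF \<epsilon>(4), of S], of 0])
             (use le l(1) in \<open>auto simp: abs_mult less_imp_le\<close>)
        then have "(\<Sum>n. l n * norm (e n f)) \<le> (\<Sum>n. l n / \<epsilon> n) * S"
          using suminf_le[OF le _ summable_mult2[OF \<epsilon>(4)]] suminf_mult2[OF \<epsilon>(4), of S] by simp
        also have "\<dots> \<le> (1 + (\<Sum>n. l n / \<epsilon> n)) * S" using S by (intro mult_right_mono) auto
        finally have "C * (\<Sum>n. l n * norm (e n f)) \<le> C' * S"
          unfolding C'_def mult.assoc using C(1) by (intro mult_left_mono) auto
        with C(2) f have "p k f \<le> C' * S" by (meson order_trans)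
        then show ?thesis by (simp add: S_def norm_e[OF f])
      qed
      ultimately show "\<exists>C\<ge>1. \<forall>f \<in> ?W. p k f \<le> C * (SUP n. norm (op_T K f (x n)) * \<nu> (x n) * \<epsilon> n)" by auto
    qed
  qed
qed

end
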